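(* Let $n,m\ge 1$ be integers and let $Q_{n,m}$ be the quandle defined in the context. 1) Up to equivalence, the irreducible quandle representations of $Q_{n,m}$ over $\mathbb{C}$ of dimension greater than $1$ are the representations $\rho_{\alpha,\lambda,\beta}: Q_{n,m}\to GL_d(\mathbb{C})$, where $d>1$ is an integer dividing both $n$ and $m$, $\alpha$ is a primitive $d$-th root of unity and $\lambda,\beta\in\mathbb{C}^\times$. 2) Two such representations $\rho_{\alpha,\lambda,\beta}$ and $\rho_{\alpha',\lambda',\beta'}$ are equivalent if and only if $\alpha=\alpha'$, $\lambda=\lambda'$ and $\beta=\beta'\alpha^i$ for some integer $i$.
   Context: A quandle is a set $Q$ with a binary operation $\triangleright$ such that: $x\triangleright x=x$ for all $x\in Q$; for all $x,y\in Q$ there is a unique $z\in Q$ with $x\triangleright z=y$; and $x\triangleright(y\triangleright z)=(x\triangleright y)\triangleright(x\triangleright z)$ for all $x,y,z\in Q$. A quandle representation of $Q$ on a vector space $V$ is a map $\rho:Q\to GL(V)$ with $\rho(x\triangleright y)=\rho(x)\rho(y)\rho(x)^{-1}$ for all $x,y\in Q$. It is irreducible if the only vector subspaces of $V$ stable under all elements of $\rho(Q)$ are $0$ and $V$. Two representations $\rho:Q\to GL(V)$, $\rho':Q\to GL(V')$ are equivalent if there is a linear isomorphism $T:V\to V'$ with $T\rho(x)=\rho'(x)T$ for all $x\in Q$. $Q_{n,m}$ is the disjoint union $\{x_i \mid i\in\mathbb{Z}/n\mathbb{Z}\}\cup\{y_i\mid i\in\mathbb{Z}/m\mathbb{Z}\}$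 (with $n+m$ elements) with the operation $x_i\triangleright y_j=y_{j+1}$, $y_i\triangleright x_j=x_{j+1}$, $x_i\triangleright x_j=x_j$, $y_i\triangleright y_j=y_j$; it is a quandle. For an integer $d>1$ dividing $n$ and $m$, a primitive $d$-th root of unity $\alpha\in\mathbb{C}$ and $\lambda,\beta\in\mathbb{C}^\times$, the quandle representation $\rho_{\alpha,\lambda,\beta}:Q_{n,m}\to GL_d(\mathbb{C})$ is given by $\rho_{\alpha,\lambda,\beta}(x_i)=\alpha^{i-1}A$ for $i\in\mathbb{Z}/n\mathbb{Z}$ and $\rho_{\alpha,\lambda,\beta}(y_j)=\alpha^{1-j}B$ for $j\in\mathbb{Z}/m\mathbb{Z}$, where $A$ is the diagonal matrix $\mathrm{diag}(\beta,\beta\alpha^{-1},\dots,\beta\alpha^{-(d-1)})$ and $B$ is the matrix sending the canonical basis $(e_1,\dots,e_d)$ as $Be_k=e_{k+1}$ for $1\le k\le d-1$ and $Be_d=\lambda e_1$. *)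

theory Defs
  imports "Jordan_Normal_Form.VS_Connect" "HOL-Algebra.Bij"
begin

record 'a quandle_struct = "'a partial_object" +
  qop :: "'a \<Rightarrow> 'a \<Rightarrow> 'a" (infixl "\<triangleright>\<index>" 70)

locale quandle =
  fixes Q (structure)
  assumes qop_closed: "\<lbrakk>x \<in> carrier Q; y \<in> carrier Q\<rbrakk> \<Longrightarrow> x \<triangleright> y \<in> carrier Q"
    and qop_idem: "x \<in> carrier Q \<Longrightarrow> x \<triangleright> x = x"
    and qop_div: "\<lbrakk>x \<in> carrier Q; y \<in> carrier Q\<rbrakk> \<Longrightarrow> \<exists>!z. z \<in> carrier Q \<and> x \<triangleright> z = y"
    and qop_distrib: "\<lbrakk>x \<in> carrier Q; y \<in> carrier Q; z \<in> carrier Q\<rbrakk>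
      \<Longrightarrow> x \<triangleright> (y \<triangleright> z) = (x \<triangleright> y) \<triangleright> (x \<triangleright> z)"

text \<open>
  A complex vector space is a \<^const>\<open>vectorspace\<close> over \<^term>\<open>class_ring :: complex ring\<close>; it may be
  infinite-dimensional. As in \<^const>\<open>BijGroup\<close>, the elements of \<open>GL V\<close> are functions that are
  \<^const>\<open>undefined\<close> outside the carrier of \<open>V\<close>, so that each linear automorphism occurs exactly once.
\<close>

definition GL :: "(complex, 'v, 'w) module_scheme \<Rightarrow> ('v \<Rightarrow> 'v) monoid" where
  "GL V = (BijGroup (carrier V))\<lparr>carrier := Bij (carrier V) \<inter> LinearCombinations.module_hom class_ring V V\<rparr>"

lemma group_GL:
  assumes V: "vectorspace (class_ring :: complex ring) V"
  shows "group (GL V)"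
proof -
  interpret vectorspace "class_ring :: complex ring" V by (rule V)
  interpret B: group "BijGroup (carrier V)" by (rule group_BijGroup)
  let ?L = "LinearCombinations.module_hom class_ring V V"
  have "subgroup (Bij (carrier V) \<inter> ?L) (BijGroup (carrier V))"
  proof (rule B.subgroupI)
    show "Bij (carrier V) \<inter> ?L \<subseteq> carrier (BijGroup (carrier V))" by (auto simp: BijGroup_def)
    have "(\<lambda>x\<in>carrier V. x) \<in> Bij (carrier V) \<inter> ?L"
      by (auto simp: id_Bij LinearCombinations.module_hom_def)
    then show "Bij (carrier V) \<inter> ?L \<noteq> {}" by blast
  next
    fix f assume f: "f \<in> Bij (carrier V) \<inter> ?L"
    then have B: "f \<in> Bij (carrier V)" and lin: "f \<in> ?L" by auto
    let ?g = "inv_into (carrier V) f"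
    have im: "f ` carrier V = carrier V" using B by (auto simp: Bij_def bij_betw_def)
    have g: "?g x \<in> carrier V" if "x \<in> carrier V" for x
      using Bij_inv_into_mem[OF B that] .
    have "?g (x \<oplus>\<^bsub>V\<^esub> y) = ?g x \<oplus>\<^bsub>V\<^esub> ?g y" if "x \<in> carrier V" "y \<in> carrier V" for x y
      by (rule Bij_inv_into_lemma[OF _ B])
        (use lin that in \<open>auto simp: LinearCombinations.module_hom_def\<close>)
    moreover have "?g (c \<odot>\<^bsub>V\<^esub> y) = c \<odot>\<^bsub>V\<^esub> ?g y" if "y \<in> carrier V" for c y
    proof -
      have "f (c \<odot>\<^bsub>V\<^esub> ?g y) = c \<odot>\<^bsub>V\<^esub> y"
        using lin g[OF that] im that by (simp add: LinearCombinations.module_hom_def class_ring_simps f_inv_into_f)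
      moreover have "c \<odot>\<^bsub>V\<^esub> ?g y \<in> carrier V" using g[OF that] by (simp add: class_ring_simps)
      ultimately show ?thesis using B by (metis Bij_def IntD2 bij_betw_imp_inj_on inv_into_f_f mem_Collect_eq)
    qed
    ultimately have "restrict ?g (carrier V) \<in> ?L"
      using g by (auto simp: LinearCombinations.module_hom_def class_ring_simps)
    then show "inv\<^bsub>BijGroup (carrier V)\<^esub> f \<in> Bij (carrier V) \<inter> ?L"
      using B by (simp add: inv_BijGroup restrict_inv_into_Bij)
  next
    fix f g assume "f \<in> Bij (carrier V) \<inter> ?L" "g \<in> Bij (carrier V) \<inter> ?L"
    then show "f \<otimes>\<^bsub>BijGroup (carrier V)\<^esub> g \<in> Bij (carrier V) \<inter> ?L"
      using compose_Bij[of f "carrier V" g]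
      by (auto simp: BijGroup_def LinearCombinations.module_hom_def compose_def Pi_iff class_ring_simps)
  qed
  then show ?thesis
    unfolding GL_def by (rule B.subgroup_imp_group)
qed

locale quandle_representation =
  quandle Q + vectorspace "class_ring :: complex ring" V
  for Q :: "('q, 'r) quandle_struct_scheme" and V :: "(complex, 'v, 'w) module_scheme" +
  fixes \<rho> :: "'q \<Rightarrow> 'v \<Rightarrow> 'v"
  assumes rep_closed: "x \<in> carrier Q \<Longrightarrow> \<rho> x \<in> carrier (GL V)"
    and rep_conj: "\<lbrakk>x \<in> carrier Q; y \<in> carrier Q\<rbrakk>
      \<Longrightarrow> \<rho> (x \<triangleright>\<^bsub>Q\<^esub> y) = \<rho> x \<otimes>\<^bsub>GL V\<^esub> \<rho> y \<otimes>\<^bsub>GL V\<^esub> inv\<^bsub>GL V\<^esub> (\<rho> x)"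

definition irreducible_representation ::
  "('q, 'r) quandle_struct_scheme \<Rightarrow> (complex, 'v, 'w) module_scheme \<Rightarrow> ('q \<Rightarrow> 'v \<Rightarrow> 'v) \<Rightarrow> bool" where
  "irreducible_representation Q V \<rho> \<longleftrightarrow> quandle_representation Q V \<rho> \<and>
     (\<forall>W. subspace class_ring W V \<and> (\<forall>x\<in>carrier Q. \<forall>w\<in>W. \<rho> x w \<in> W) \<longrightarrow>
        W = {\<zero>\<^bsub>V\<^esub>} \<or> W = carrier V)"

definition equivalent_representations ::
  "('q, 'r) quandle_struct_scheme \<Rightarrow> (complex, 'v, 'w) module_scheme \<Rightarrow> ('q \<Rightarrow> 'v \<Rightarrow> 'v) \<Rightarrow>
   (complex, 'v', 'w') module_scheme \<Rightarrow> ('q \<Rightarrow> 'v' \<Rightarrow> 'v') \<Rightarrow> bool" where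
  "equivalent_representations Q V \<rho> V' \<rho>' \<longleftrightarrow>
     (\<exists>T. linear_map class_ring V V' T \<and> bij_betw T (carrier V) (carrier V') \<and>
        (\<forall>x\<in>carrier Q. \<forall>v\<in>carrier V. T (\<rho> x v) = \<rho>' x (T v)))"

text \<open>
  \<^const>\<open>vectorspace.dim\<close> is meaningful for finite-dimensional spaces only, hence the case distinction.
\<close>

definition dim_greater_one :: "(complex, 'v, 'w) module_scheme \<Rightarrow> bool" where
  "dim_greater_one V \<longleftrightarrow>
     \<not> vectorspace.fin_dim class_ring V \<or> vectorspace.dim class_ring V > 1"

text \<open>
  In \<open>Qnm n m\<close> the residue classes modulo \<open>n\<close> and \<open>m\<close> are represented by \<open>0, \<dots>, n - 1\<close> and
  \<open>0, \<dots>, m - 1\<close>.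
\<close>

datatype qnm_elem = X nat | Y nat

fun qnm_op :: "nat \<Rightarrow> nat \<Rightarrow> qnm_elem \<Rightarrow> qnm_elem \<Rightarrow> qnm_elem" where
  "qnm_op n m (X i) (Y j) = Y ((j + 1) mod m)"
| "qnm_op n m (Y i) (X j) = X ((j + 1) mod n)"
| "qnm_op n m (X i) (X j) = X j"
| "qnm_op n m (Y i) (Y j) = Y j"

definition Qnm :: "nat \<Rightarrow> nat \<Rightarrow> qnm_elem quandle_struct" where
  "Qnm n m = \<lparr>carrier = X ` {..<n} \<union> Y ` {..<m}, qop = qnm_op n m\<rparr>"

definition primitive_root_of_unity :: "nat \<Rightarrow> complex \<Rightarrow> bool" where
  "primitive_root_of_unity d \<alpha> \<longleftrightarrow> \<alpha> ^ d = 1 \<and> (\<forall>k. 0 < k \<and> k < d \<longrightarrow> \<alpha> ^ k \<noteq> 1)"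

abbreviation complex_space :: "nat \<Rightarrow> (complex, complex vec) module" where
  "complex_space d \<equiv> module_vec TYPE(complex) d"

text \<open>
  Matrix and vector indices start at \<open>0\<close> here: \<open>e\<^sub>1, \<dots>, e\<^sub>d\<close> are the unit vectors \<open>0, \<dots>, d - 1\<close>,
  and \<open>(i, j)\<close> is the entry in row \<open>i\<close>, column \<open>j\<close>.
\<close>

definition A_mat :: "nat \<Rightarrow> complex \<Rightarrow> complex \<Rightarrow> complex mat" where
  "A_mat d \<alpha> \<beta> = mat_diag d (\<lambda>k. \<beta> * \<alpha> powi (- int k))"

definition B_mat :: "nat \<Rightarrow> complex \<Rightarrow> complex mat" where
  "B_mat d l = Matrix.mat d d (\<lambda>(i, j).
     if j < d - 1 then (if i = j + 1 then 1 else 0) else (if i = 0 then l else 0))"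

lemma B_mat_unit_vec:
  assumes "d > 1"
  shows "k < d - 1 \<Longrightarrow> B_mat d l *\<^sub>v unit_vec d k = unit_vec d (k + 1)"
    and "B_mat d l *\<^sub>v unit_vec d (d - 1) = l \<cdot>\<^sub>v unit_vec d 0"
  using assms by (auto intro!: eq_vecI simp: B_mat_def)

text \<open>
  The exponents are well defined on residue classes since \<open>\<alpha> ^ d = 1\<close> and \<open>d\<close> divides \<open>n\<close> and \<open>m\<close>.
\<close>

fun rho_mat :: "nat \<Rightarrow> complex \<Rightarrow> complex \<Rightarrow> complex \<Rightarrow> qnm_elem \<Rightarrow> complex mat" where
  "rho_mat d \<alpha> l \<beta> (X i) = \<alpha> powi (int i - 1) \<cdot>\<^sub>m A_mat d \<alpha> \<beta>"
| "rho_mat d \<alpha> l \<beta> (Y j) = \<alpha> powi (1 - int j) \<cdot>\<^sub>m B_mat d l"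

definition rho :: "nat \<Rightarrow> complex \<Rightarrow> complex \<Rightarrow> complex \<Rightarrow> qnm_elem \<Rightarrow> complex vec \<Rightarrow> complex vec" where
  "rho d \<alpha> l \<beta> q = (\<lambda>v\<in>carrier_vec d. rho_mat d \<alpha> l \<beta> q *\<^sub>v v)"

definition rho_parameters :: "nat \<Rightarrow> nat \<Rightarrow> nat \<Rightarrow> complex \<Rightarrow> complex \<Rightarrow> complex \<Rightarrow> bool" where
  "rho_parameters n m d \<alpha> l \<beta> \<longleftrightarrow>
     d > 1 \<and> d dvd n \<and> d dvd m \<and> primitive_root_of_unity d \<alpha> \<and> l \<noteq> 0 \<and> \<beta> \<noteq> 0"

lemma Suc_mod_ex1:
  assumes "j < n"
  shows "\<exists>!i. i < n \<and> Suc i mod n = j"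
proof (rule ex1I)
  show "(if j = 0 then n - 1 else j - 1) < n \<and>
      Suc (if j = 0 then n - 1 else j - 1) mod n = j"
    using assms by (cases j) auto
next
  fix i assume i: "i < n \<and> Suc i mod n = j"
  show "i = (if j = 0 then n - 1 else j - 1)"
  proof (cases "Suc i = n")
    case True
    then show ?thesis using i by auto
  next
    case False
    then have "Suc i mod n = Suc i" using i by (intro mod_less) linarith
    then show ?thesis using i by auto
  qed
qed

lemma ex1_image: "\<exists>!k. P k \<Longrightarrow> \<exists>!z. \<exists>k. z = f k \<and> P k"
  by blast

lemma quandle_Qnm: "quandle (Qnm n m)"
proof
  fix x y assume x: "x \<in> carrier (Qnm n m)" and y: "y \<in> carrier (Qnm n m)"
  then show "x \<triangleright>\<^bsub>Qnm n m\<^esub> y \<in> carrier (Qnm n m)"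
    by (cases x; cases y) (auto simp: Qnm_def)
  show "\<exists>!z. z \<in> carrier (Qnm n m) \<and> x \<triangleright>\<^bsub>Qnm n m\<^esub> z = y"
  proof (cases x)
    case (X i)
    have "z \<in> carrier (Qnm n m) \<and> x \<triangleright>\<^bsub>Qnm n m\<^esub> z = y \<longleftrightarrow> (case y of X j \<Rightarrow> z = X j
        | Y j \<Rightarrow> (\<exists>k. z = Y k \<and> k < m \<and> Suc k mod m = j))" for z
      using X y by (cases z; cases y) (auto simp: Qnm_def)
    then show ?thesis
      using y by (cases y) (auto intro!: ex1_image Suc_mod_ex1 simp: Qnm_def simp del: ex_simps)
  next
    case (Y i)
    have "z \<in> carrier (Qnm n m) \<and> x \<triangleright>\<^bsub>Qnm n m\<^esub> z = y \<longleftrightarrow> (case y of Y j \<Rightarrow> z = Y j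
        | X j \<Rightarrow> (\<exists>k. z = X k \<and> k < n \<and> Suc k mod n = j))" for z
      using Y y by (cases z; cases y) (auto simp: Qnm_def)
    then show ?thesis
      using y by (cases y) (auto intro!: ex1_image Suc_mod_ex1 simp: Qnm_def simp del: ex_simps)
  qed
next
  fix x assume "x \<in> carrier (Qnm n m)"
  show "x \<triangleright>\<^bsub>Qnm n m\<^esub> x = x"
    by (cases x) (simp_all add: Qnm_def)
next
  fix x y z
  show "x \<triangleright>\<^bsub>Qnm n m\<^esub> (y \<triangleright>\<^bsub>Qnm n m\<^esub> z) = (x \<triangleright>\<^bsub>Qnm n m\<^esub> y) \<triangleright>\<^bsub>Qnm n m\<^esub> (x \<triangleright>\<^bsub>Qnm n m\<^esub> z)"
    by (cases x; cases y; cases z) (simp_all add: Qnm_def)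
qed

end

theory Submission
  imports Defs "HOL-Computational_Algebra.Fundamental_Theorem_Algebra"
    "HOL-Analysis.Continuum_Not_Denumerable"
begin

text \<open>
  In a representation \<open>\<rho>\<close> of \<open>Q\<^bsub>n,m\<^esub>\<close> put \<open>a = \<rho>(x\<^sub>1)\<close> and \<open>b = \<rho>(y\<^sub>1)\<close>. The quandle relations give
  \<open>\<rho>(x\<^sub>i) \<rho>(y\<^sub>j) = \<rho>(x\<^bsub>i+1\<^esub>) \<rho>(y\<^bsub>j+1\<^esub>)\<close>, so \<open>\<rho>(y\<^bsub>j+1\<^esub>) \<rho>(y\<^sub>j)\<^sup>-\<^sup>1 = \<rho>(x\<^bsub>i+1\<^esub>)\<^sup>-\<^sup>1 \<rho>(x\<^sub>i)\<close> does not
  depend on \<open>i\<close> and \<open>j\<close> and commutes with everything. If \<open>\<rho>\<close> is irreducible, then by Schur's lemma (in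
  Dixmier's form, since \<open>V\<close> is not assumed to be finite-dimensional) it is a scalar \<open>\<alpha>\<^sup>-\<^sup>1\<close>, where
  \<open>\<alpha>\<close> is a root of unity of some order \<open>d\<close> dividing \<open>n\<close> and \<open>m\<close>, and \<open>b a = \<alpha> a b\<close>. Now \<open>a\<^sup>d\<close> and
  \<open>b\<^sup>d\<close> are central too, hence scalars; so \<open>a\<close> has an eigenvector \<open>v\<close>, and \<open>v, b v, \<dots>, b\<^bsup>d-1\<^esup> v\<close>
  is a basis in which \<open>\<rho>\<close> takes the stated form. The parameters are recovered from \<open>\<rho>(x\<^sub>1) = \<alpha> \<rho>(x\<^sub>0)\<close>,
  \<open>b\<^sup>d = \<lambda>\<close> and the eigenvalues \<open>\<beta> \<alpha>\<^bsup>-k\<^esup>\<close> of \<open>a\<close>; conversely \<open>b\<close> itself intertwines the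
  representations with parameters \<open>\<beta>\<close> and \<open>\<alpha> \<beta>\<close>.
\<close>

section \<open>Operators on complex vector spaces\<close>

locale complex_vectorspace = vectorspace "class_ring :: complex ring" V
  for V :: "(complex, 'v, 'w) module_scheme"
begin

lemma smult_closed_complex [simp, intro]: "v \<in> carrier V \<Longrightarrow> c \<odot>\<^bsub>V\<^esub> v \<in> carrier V"
  by (simp add: class_ring_simps)

text \<open>The module axioms with the operations of \<open>class_ring\<close> unfolded to ordinary
  complex arithmetic, so that the simplifier can compute with scalars directly.\<close>

lemma smult_simps:
  shows "v \<in> carrier V \<Longrightarrow> (c + d) \<odot>\<^bsub>V\<^esub> v = c \<odot>\<^bsub>V\<^esub> v \<oplus>\<^bsub>V\<^esub> d \<odot>\<^bsub>V\<^esub> v"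
    and "\<lbrakk>v \<in> carrier V; w \<in> carrier V\<rbrakk> \<Longrightarrow> c \<odot>\<^bsub>V\<^esub> (v \<oplus>\<^bsub>V\<^esub> w) = c \<odot>\<^bsub>V\<^esub> v \<oplus>\<^bsub>V\<^esub> c \<odot>\<^bsub>V\<^esub> w"
    and "v \<in> carrier V \<Longrightarrow> c \<odot>\<^bsub>V\<^esub> (d \<odot>\<^bsub>V\<^esub> v) = (c * d) \<odot>\<^bsub>V\<^esub> v"
    and "v \<in> carrier V \<Longrightarrow> 1 \<odot>\<^bsub>V\<^esub> v = v" and "v \<in> carrier V \<Longrightarrow> 0 \<odot>\<^bsub>V\<^esub> v = \<zero>\<^bsub>V\<^esub>"
    and "c \<odot>\<^bsub>V\<^esub> \<zero>\<^bsub>V\<^esub> = \<zero>\<^bsub>V\<^esub>"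
  using smult_l_distr[of c d v] smult_r_distr[of c v w] smult_assoc1[of c d v] smult_one[of v]
    lmult_0[of v] rmult_0[of c]
  by (simp_all add: class_ring_simps)

lemma smult_eq_zero_iff:
  assumes "v \<in> carrier V"
  shows "c \<odot>\<^bsub>V\<^esub> v = \<zero>\<^bsub>V\<^esub> \<longleftrightarrow> c = 0 \<or> v = \<zero>\<^bsub>V\<^esub>"
proof
  assume *: "c \<odot>\<^bsub>V\<^esub> v = \<zero>\<^bsub>V\<^esub>"
  show "c = 0 \<or> v = \<zero>\<^bsub>V\<^esub>"
  proof (rule disjCI)
    assume "v \<noteq> \<zero>\<^bsub>V\<^esub>"
    then show "c = 0"
      using arg_cong[OF *, of "\<lambda>w. inverse c \<odot>\<^bsub>V\<^esub> w"] assms smult_simps(3,4)[OF assms] smult_simps(6)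
      by (metis field_class.field_inverse)
  qed
qed (use assms smult_simps(5)[OF assms] smult_simps(6) in auto)

lemma add_minus_one_smult:
  assumes "v \<in> carrier V" "w \<in> carrier V"
  shows "v \<oplus>\<^bsub>V\<^esub> (-1) \<odot>\<^bsub>V\<^esub> w = \<zero>\<^bsub>V\<^esub> \<longleftrightarrow> v = w"
proof -
  have "(-1) \<odot>\<^bsub>V\<^esub> w = \<ominus>\<^bsub>V\<^esub> w"
    using smult_minus_1[of w] assms by (simp add: class_ring_simps)
  then show ?thesis
    using assms M.r_neg[of w] M.minus_equality[of v "\<ominus>\<^bsub>V\<^esub> w"] by auto
qed

text \<open>A countable set has only countably many finite subsets, so by the pigeonhole principle
  one finite \<open>B\<close> contains infinitely many of the uncountably many vectors
  \<open>u c\<close> in its span. More than \<open>card B\<close> independent vectors there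
  contradict the exchange lemma.\<close>

lemma countable_span_no_uncountable_independent:
  assumes S: "countable S" "S \<subseteq> carrier V"
    and u: "\<And>c :: complex. u c \<in> span S"
    and indep: "\<And>F a c. finite F \<Longrightarrow> (\<Oplus>\<^bsub>V\<^esub>c\<in>F. a c \<odot>\<^bsub>V\<^esub> u c) = \<zero>\<^bsub>V\<^esub> \<Longrightarrow> c \<in> F \<Longrightarrow> a c = 0"
  shows False
proof -
  have uV: "u c \<in> carrier V" for c :: complex
    using u span_is_subset2[OF S(2)] by blast
  \<comment> \<open>Injectivity allows sums indexed by complex numbers to be read as linear
    combinations over a set of vectors. A coincidence of two vectors would be the relation
    \<open>u c - u d = 0\<close>.\<close>
  have "inj u"
  proof (rule injI, rule ccontr)
    fix c d assume eq: "u c = u d" and ne: "c \<noteq> d"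
    have "(\<Oplus>\<^bsub>V\<^esub>x\<in>{c, d}. (if x = c then 1 else - 1) \<odot>\<^bsub>V\<^esub> u x) = u c \<oplus>\<^bsub>V\<^esub> (-1) \<odot>\<^bsub>V\<^esub> u d"
      using ne uV smult_simps(4)[OF uV] by (simp add: M.finsum_insert)
    then show False
      using indep[of "{c, d}" "\<lambda>x. if x = c then 1 else - 1" c] eq uV
      by (simp add: add_minus_one_smult)
  qed
  have "\<exists>A. finite A \<and> A \<subseteq> S \<and> u c \<in> span A" for c
  proof -
    obtain a A where "finite A" "A \<subseteq> S" "u c = lincomb a A"
      using u[of c] unfolding span_def by blast
    then show ?thesis unfolding span_def by (auto simp: class_ring_simps)
  qed
  then obtain A where A: "\<And>c. finite (A c) \<and> A c \<subseteq> S \<and> u c \<in> span (A c)" by metis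
  have "countable (range A)"
    using A by (intro countable_subset[OF _ countable_Collect_finite_subset[OF S(1)]]) auto
  moreover have "(UNIV :: complex set) = (\<Union>B\<in>range A. {c. A c = B})" by auto
  ultimately obtain B where B: "B \<in> range A" "infinite {c. A c = B}"
    using uncountable_UNIV_complex by (metis countable_UN countable_finite)
  then obtain F where F: "F \<subseteq> {c. A c = B}" "finite F" "card F = Suc (card B)"
    by (meson infinite_arbitrarily_large)
  have "lin_indpt (u ` F)"
  proof (rule finite_lin_indpt2)
    fix a assume "lincomb a (u ` F) = \<zero>\<^bsub>V\<^esub>"
    then have "(\<Oplus>\<^bsub>V\<^esub>c\<in>F. a (u c) \<odot>\<^bsub>V\<^esub> u c) = \<zero>\<^bsub>V\<^esub>"
      unfolding lincomb_def using uV \<open>inj u\<close>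
      by (subst (asm) M.finsum_reindex) (auto simp: inj_on_def)
    from indep[OF F(2) this] show "\<forall>v\<in>u ` F. a v = \<zero>\<^bsub>class_ring\<^esub>" by simp
  qed (use F uV in auto)
  moreover have "u ` F \<subseteq> span B" using F A by blast
  moreover have "finite B" "B \<subseteq> carrier V" using B A S by blast+
  \<comment> \<open>\<open>replacement\<close> is the Steinitz exchange lemma: the size of its
    complementing set is \<open>card B - card (u ' F)\<close> at most, hence this difference is
    non-negative.\<close>
  ultimately have "int (card (u ` F)) \<le> int (card B)"
    using replacement[of "u ` F" B, OF finite_imageI[OF F(2)]] by force
  moreover have "card (u ` F) = card F"
    by (rule card_image[OF inj_on_subset[OF \<open>inj u\<close> subset_UNIV]])
  ultimately show False using F(3) by simp
qed

end

section \<open>Polynomials in a linear operator and eigenvectors\<close>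

locale complex_endomorphism = complex_vectorspace V
  for V :: "(complex, 'v, 'w) module_scheme" +
  fixes T
  assumes T_hom: "T \<in> LinearCombinations.module_hom class_ring V V"
begin

lemma T_closed [simp, intro]: "v \<in> carrier V \<Longrightarrow> T v \<in> carrier V"
  and T_add: "\<lbrakk>v \<in> carrier V; w \<in> carrier V\<rbrakk> \<Longrightarrow> T (v \<oplus>\<^bsub>V\<^esub> w) = T v \<oplus>\<^bsub>V\<^esub> T w"
  and T_smult: "v \<in> carrier V \<Longrightarrow> T (c \<odot>\<^bsub>V\<^esub> v) = c \<odot>\<^bsub>V\<^esub> T v"
  using T_hom by (auto simp: LinearCombinations.module_hom_def class_ring_simps)

lemma T_zero [simp]: "T \<zero>\<^bsub>V\<^esub> = \<zero>\<^bsub>V\<^esub>"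
  using T_smult[of "\<zero>\<^bsub>V\<^esub>" 0] smult_simps(5)[of "T \<zero>\<^bsub>V\<^esub>"]
  by (simp add: smult_simps(6))

lemma T_finsum: "g \<in> F \<rightarrow> carrier V \<Longrightarrow> T (\<Oplus>\<^bsub>V\<^esub>i\<in>F. g i) = (\<Oplus>\<^bsub>V\<^esub>i\<in>F. T (g i))"
  by (induction F rule: infinite_finite_induct) (auto simp: T_add M.finsum_insert Pi_iff)

lemma funpow_closed [simp, intro]: "v \<in> carrier V \<Longrightarrow> (T ^^ k) v \<in> carrier V"
  by (induction k) auto

text \<open>This is \<open>p(T) v\<close> evaluated by Horner's scheme. With
  \<open>fold_coeffs\<close> the value obeys a recursion along \<open>pCons\<close>, on which the
  inductions below run.\<close>

definition poly_op :: "complex poly \<Rightarrow> 'v \<Rightarrow> 'v" where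
  "poly_op p v = fold_coeffs (\<lambda>a w. a \<odot>\<^bsub>V\<^esub> v \<oplus>\<^bsub>V\<^esub> T w) p \<zero>\<^bsub>V\<^esub>"

lemma poly_op_0 [simp]: "poly_op 0 v = \<zero>\<^bsub>V\<^esub>"
  by (simp add: poly_op_def)

lemma poly_op_pCons [simp]:
  "v \<in> carrier V \<Longrightarrow> poly_op (pCons a p) v = a \<odot>\<^bsub>V\<^esub> v \<oplus>\<^bsub>V\<^esub> T (poly_op p v)"
  by (cases "p = 0 \<and> a = 0") (auto simp: poly_op_def smult_simps)

lemma poly_op_closed [simp, intro]: "v \<in> carrier V \<Longrightarrow> poly_op p v \<in> carrier V"
  by (induction p) auto

lemma poly_op_add: "v \<in> carrier V \<Longrightarrow> poly_op (p + q) v = poly_op p v \<oplus>\<^bsub>V\<^esub> poly_op q v"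
proof (induction p q rule: poly_induct2)
  case (pCons a p b q)
  then show ?case by (simp add: smult_simps T_add M.a_ac)
qed simp

lemma poly_op_smult: "v \<in> carrier V \<Longrightarrow> poly_op (Polynomial.smult c p) v = c \<odot>\<^bsub>V\<^esub> poly_op p v"
  by (induction p) (auto simp: smult_simps T_smult)

lemma poly_op_linear_factor:
  "v \<in> carrier V \<Longrightarrow> poly_op ([:- c, 1:] * p) v = T (poly_op p v) \<oplus>\<^bsub>V\<^esub> (- c) \<odot>\<^bsub>V\<^esub> poly_op p v"
  using poly_op_add[of v "Polynomial.smult (- c) p" "pCons 0 p"] poly_op_smult[of v "- c" p]
  by (simp add: smult_simps(5) M.a_comm)

lemma poly_op_monom: "v \<in> carrier V \<Longrightarrow> poly_op (monom 1 k) v = (T ^^ k) v"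
  by (induction k) (auto simp: monom_0 monom_Suc smult_simps)

lemma eigen_iff:
  assumes "v \<in> carrier V"
  shows "T v \<oplus>\<^bsub>V\<^esub> (- c) \<odot>\<^bsub>V\<^esub> v = \<zero>\<^bsub>V\<^esub> \<longleftrightarrow> T v = c \<odot>\<^bsub>V\<^esub> v"
  using add_minus_one_smult[of "T v" "c \<odot>\<^bsub>V\<^esub> v"] assms by (simp add: smult_simps)

text \<open>Split off a root: \<open>p = (x - c) q\<close>. Either \<open>q(T) v\<close> is already
  zero and the degree has dropped, or \<open>q(T) v\<close> is an eigenvector for \<open>c\<close>.
  A nonzero constant cannot annihilate \<open>v\<close>, so the descent stops in time.\<close>

lemma annihilated_imp_eigenvector:
  assumes "p \<noteq> 0" "v \<in> carrier V" "v \<noteq> \<zero>\<^bsub>V\<^esub>" "poly_op p v = \<zero>\<^bsub>V\<^esub>"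
  obtains c w where "w \<in> carrier V" "w \<noteq> \<zero>\<^bsub>V\<^esub>" "T w = c \<odot>\<^bsub>V\<^esub> w"
  using assms
proof (induction "degree p" arbitrary: p thesis)
  case 0
  then obtain a where "p = [:a:]" "a \<noteq> 0" by (metis degree_eq_zeroE pCons_0_0)
  then show ?case using 0 by (simp add: smult_eq_zero_iff)
next
  case (Suc n)
  then have "\<not> constant (poly p)" by (simp add: constant_degree)
  then obtain c where "poly p c = 0" using fundamental_theorem_of_algebra by blast
  then obtain q where q: "p = [:- c, 1:] * q" unfolding poly_eq_0_iff_dvd by blast
  then have "q \<noteq> 0" using Suc by auto
  then have "degree q = n" using Suc(2) unfolding q by (subst (asm) degree_mult_eq) auto
  show ?case
  proof (cases "poly_op q v = \<zero>\<^bsub>V\<^esub>")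
    case True
    then show ?thesis using Suc.hyps(1)[of q] \<open>degree q = n\<close> \<open>q \<noteq> 0\<close> Suc.prems by blast
  next
    case False
    have "T (poly_op q v) \<oplus>\<^bsub>V\<^esub> (- c) \<odot>\<^bsub>V\<^esub> poly_op q v = \<zero>\<^bsub>V\<^esub>"
      using Suc.prems(3,5) poly_op_linear_factor[of v c q] q by metis
    with False show ?thesis
      using Suc.prems(1)[of "poly_op q v" c] Suc.prems(3) by (simp add: eigen_iff)
  qed
qed

text \<open>Applying \<open>T - d\<close> removes the summand with index \<open>d\<close>, and \<open>(T - d) (u c) = v + (c - d) u c\<close>.\<close>

lemma resolvent_vectors_independent:
  assumes no_eigen: "\<And>c w. w \<in> carrier V \<Longrightarrow> T w = c \<odot>\<^bsub>V\<^esub> w \<Longrightarrow> w = \<zero>\<^bsub>V\<^esub>"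
    and v: "v \<in> carrier V" "v \<noteq> \<zero>\<^bsub>V\<^esub>"
    and u: "\<And>c. u c \<in> carrier V" "\<And>c. T (u c) = v \<oplus>\<^bsub>V\<^esub> c \<odot>\<^bsub>V\<^esub> u c"
    and "finite F"
    and "poly_op f v \<oplus>\<^bsub>V\<^esub> (\<Oplus>\<^bsub>V\<^esub>c\<in>F. a c \<odot>\<^bsub>V\<^esub> u c) = \<zero>\<^bsub>V\<^esub>"
  shows "f = 0 \<and> (\<forall>c\<in>F. a c = 0)"
  using \<open>finite F\<close> assms(7)
proof (induction F arbitrary: f a rule: finite_induct)
  \<comment> \<open>Only the polynomial is left; if it were nonzero, annihilating \<open>v\<close>
    would produce an eigenvector.\<close>
  case empty
  then have "poly_op f v = \<zero>\<^bsub>V\<^esub>" using v by simp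
  then have "f = 0" using annihilated_imp_eigenvector[of f v] no_eigen v by metis
  then show ?case by simp
next
  case (insert d F)
  define D where "D w = T w \<oplus>\<^bsub>V\<^esub> (- d) \<odot>\<^bsub>V\<^esub> w" for w
  have D_hom: "D \<in> LinearCombinations.module_hom class_ring V V"
    by (auto simp: LinearCombinations.module_hom_def D_def class_ring_simps T_add T_smult
        smult_simps M.a_ac mult.commute)
  interpret D: complex_endomorphism V D by unfold_locales (rule D_hom)
  have Du: "D (u c) = v \<oplus>\<^bsub>V\<^esub> (c - d) \<odot>\<^bsub>V\<^esub> u c" for c
    using v u(1)[of c] smult_simps(1)[of "u c" c "- d"] by (simp add: D_def u(2) M.a_ac)
  let ?S = "\<Oplus>\<^bsub>V\<^esub>c\<in>F. a c \<odot>\<^bsub>V\<^esub> u c"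
  let ?S' = "\<Oplus>\<^bsub>V\<^esub>c\<in>F. (a c * (c - d)) \<odot>\<^bsub>V\<^esub> u c"
  have SV: "?S \<in> carrier V" "?S' \<in> carrier V"
    using u by (auto intro!: M.finsum_closed)
  have eq: "poly_op f v \<oplus>\<^bsub>V\<^esub> (a d \<odot>\<^bsub>V\<^esub> u d \<oplus>\<^bsub>V\<^esub> ?S) = \<zero>\<^bsub>V\<^esub>"
    using insert u by (simp add: M.finsum_insert)
  have DS: "D ?S = (\<Sum>c\<in>F. a c) \<odot>\<^bsub>V\<^esub> v \<oplus>\<^bsub>V\<^esub> ?S'"
  proof -
    have "D ?S = (\<Oplus>\<^bsub>V\<^esub>c\<in>F. D (a c \<odot>\<^bsub>V\<^esub> u c))"
      by (rule D.T_finsum) (use u in auto)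
    also have "\<dots> = (\<Oplus>\<^bsub>V\<^esub>c\<in>F. a c \<odot>\<^bsub>V\<^esub> v \<oplus>\<^bsub>V\<^esub> (a c * (c - d)) \<odot>\<^bsub>V\<^esub> u c)"
      by (rule M.finsum_cong') (use u v in \<open>auto simp: D.T_smult Du smult_simps\<close>)
    also have "\<dots> = (\<Oplus>\<^bsub>V\<^esub>c\<in>F. a c \<odot>\<^bsub>V\<^esub> v) \<oplus>\<^bsub>V\<^esub> ?S'"
      by (rule M.finsum_addf) (use u v in auto)
    also have "(\<Oplus>\<^bsub>V\<^esub>c\<in>F. a c \<odot>\<^bsub>V\<^esub> v) = (\<Sum>c\<in>F. a c) \<odot>\<^bsub>V\<^esub> v"
      using finsum_smult_r[of v a F] v by (simp add: class_ring_simps)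
    finally show ?thesis .
  qed
  \<comment> \<open>Each \<open>(T - d) (u c)\<close> leaves a copy of \<open>v\<close> behind. The
    polynomial term in the statement absorbs these copies, which is what lets the induction pass:
    \<open>?g\<close> is the polynomial term after \<open>T - d\<close> has been applied to the
    relation.\<close>
  let ?g = "[:- d, 1:] * f + [:\<Sum>c\<in>insert d F. a c:]"
  have "\<zero>\<^bsub>V\<^esub> = D (poly_op f v \<oplus>\<^bsub>V\<^esub> (a d \<odot>\<^bsub>V\<^esub> u d \<oplus>\<^bsub>V\<^esub> ?S))"
    unfolding eq by simp
  also have "\<dots> = D (poly_op f v) \<oplus>\<^bsub>V\<^esub> (a d \<odot>\<^bsub>V\<^esub> v \<oplus>\<^bsub>V\<^esub> ((\<Sum>c\<in>F. a c) \<odot>\<^bsub>V\<^esub> v \<oplus>\<^bsub>V\<^esub> ?S'))"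
    using v u SV Du[of d] by (simp add: D.T_add D.T_smult DS smult_simps)
  also have "\<dots> = (D (poly_op f v) \<oplus>\<^bsub>V\<^esub> (\<Sum>c\<in>insert d F. a c) \<odot>\<^bsub>V\<^esub> v) \<oplus>\<^bsub>V\<^esub> ?S'"
    using v SV insert.hyps by (simp add: smult_simps(1)[OF v(1)] M.a_assoc)
  also have "D (poly_op f v) \<oplus>\<^bsub>V\<^esub> (\<Sum>c\<in>insert d F. a c) \<odot>\<^bsub>V\<^esub> v = poly_op ?g v"
    using poly_op_linear_factor[OF v(1), of d f] v unfolding poly_op_add[OF v(1)] D_def by simp
  finally have *: "?g = 0 \<and> (\<forall>c\<in>F. a c * (c - d) = 0)"
    by (intro insert.IH) (rule sym)
  have aF: "\<forall>c\<in>F. a c = 0" using conjunct2[OF *] insert.hyps by auto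
  \<comment> \<open>At \<open>d\<close> the product vanishes and only the sum of the coefficients
    remains, which is \<open>a d\<close> because the others are zero by now.\<close>
  have "poly ?g d = 0" by (simp only: conjunct1[OF *] poly_0)
  then have "a d = 0" using aF insert.hyps by simp
  then have "[:- d, 1:] * f = 0" using conjunct1[OF *] aF insert.hyps by simp
  then have "f = 0" by (simp only: mult_eq_0_iff) simp
  with aF \<open>a d = 0\<close> show ?case by simp
qed

end

section \<open>Schur's lemma in countable dimension\<close>

lemma (in complex_vectorspace) subspaceI:
  assumes "W \<subseteq> carrier V" "\<zero>\<^bsub>V\<^esub> \<in> W"
    and "\<And>v w. \<lbrakk>v \<in> W; w \<in> W\<rbrakk> \<Longrightarrow> v \<oplus>\<^bsub>V\<^esub> w \<in> W" "\<And>c v. v \<in> W \<Longrightarrow> c \<odot>\<^bsub>V\<^esub> v \<in> W"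
  shows "VectorSpace.subspace class_ring W V"
  using assms by (auto simp: VectorSpace.subspace_def submodule_def vectorspace_axioms module_axioms)

sublocale quandle_representation \<subseteq> complex_vectorspace V ..

context quandle_representation
begin

lemma rep_Bij: "x \<in> carrier Q \<Longrightarrow> \<rho> x \<in> Bij (carrier V)"
  and rep_hom: "x \<in> carrier Q \<Longrightarrow> \<rho> x \<in> LinearCombinations.module_hom class_ring V V"
  using rep_closed by (auto simp: GL_def)

lemma rep_endomorphism: "x \<in> carrier Q \<Longrightarrow> complex_endomorphism V (\<rho> x)"
  by unfold_locales (rule rep_hom)

lemmas rep_vec_closed [simp, intro] = complex_endomorphism.T_closed[OF rep_endomorphism]
  and rep_add = complex_endomorphism.T_add[OF rep_endomorphism]
  and rep_smult = complex_endomorphism.T_smult[OF rep_endomorphism]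
  and rep_zero [simp] = complex_endomorphism.T_zero[OF rep_endomorphism]

text \<open>The span of the orbit is invariant and contains \<open>v\<close>, so irreducibility
  makes it everything. The orbit is indexed by finite words over the quandle and is therefore
  countable whenever the quandle is; this is how the dimension of \<open>V\<close> is
  bounded.\<close>

lemma orbit_span_eq_carrier:
  assumes irr: "\<And>W. \<lbrakk>VectorSpace.subspace class_ring W V; \<And>x w. \<lbrakk>x \<in> carrier Q; w \<in> W\<rbrakk> \<Longrightarrow> \<rho> x w \<in> W\<rbrakk>
      \<Longrightarrow> W = {\<zero>\<^bsub>V\<^esub>} \<or> W = carrier V"
    and v: "v \<in> carrier V" "v \<noteq> \<zero>\<^bsub>V\<^esub>"
  defines "S \<equiv> (\<lambda>xs. foldr \<rho> xs v) ` lists (carrier Q)"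
  shows "S \<subseteq> carrier V" and "span S = carrier V"
proof -
  have "foldr \<rho> xs v \<in> carrier V" if "xs \<in> lists (carrier Q)" for xs
    using that v by (induction xs) auto
  then show SV: "S \<subseteq> carrier V" unfolding S_def by blast
  have "v \<in> S" unfolding S_def by (rule image_eqI[of _ _ "[]"]) auto
  then have "v \<in> span S" using in_own_span[OF SV] by blast
  have sub: "VectorSpace.subspace class_ring (span S) V" by (rule span_is_subspace[OF SV])
  then interpret sp: submodule class_ring "span S" V by (simp add: VectorSpace.subspace_def)
  have "\<rho> x w \<in> span S" if x: "x \<in> carrier Q" and w: "w \<in> span S" for x w
  proof -
    have "\<rho> x s \<in> S" if s: "s \<in> S" for s
    proof -
      obtain xs where xs: "xs \<in> lists (carrier Q)" "s = foldr \<rho> xs v"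
        using s unfolding S_def by blast
      show ?thesis unfolding S_def
        by (rule image_eqI[of _ _ "x # xs"]) (use xs x in auto)
    qed
    \<comment> \<open>Invariance is extended from the generators to their span: the preimage of the
      span under \<open>\<rho> x\<close> is a subspace containing \<open>S\<close>.\<close>
    then have "S \<subseteq> {w \<in> carrier V. \<rho> x w \<in> span S}"
      using SV in_own_span[OF SV] by blast
    moreover have "VectorSpace.subspace class_ring {w \<in> carrier V. \<rho> x w \<in> span S} V"
      by (rule subspaceI) (use x in \<open>auto simp: rep_add rep_smult\<close>)
    ultimately have "span S \<subseteq> {w \<in> carrier V. \<rho> x w \<in> span S}"
      by (intro span_is_subset) auto
    then show ?thesis using w by blast
  qed
  from irr[OF sub this] show "span S = carrier V"
    using v \<open>v \<in> span S\<close> by blast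
qed

end

text \<open>Dixmier's form of Schur's lemma: \<open>V\<close> may be infinite-dimensional, but its dimension is countable,
  whereas an operator without eigenvector would provide the uncountable independent family
  \<open>(T - c)\<^sup>-\<^sup>1 v\<close>.\<close>

lemma irreducible_commuting_scalar:
  fixes V :: "(complex, 'v, 'w) module_scheme"
  assumes irr: "irreducible_representation Q V \<rho>"
    and countable: "countable (carrier Q)"
    and hom: "T \<in> LinearCombinations.module_hom class_ring V V"
    and comm: "\<And>x v. \<lbrakk>x \<in> carrier Q; v \<in> carrier V\<rbrakk> \<Longrightarrow> T (\<rho> x v) = \<rho> x (T v)"
  obtains c where "\<And>v. v \<in> carrier V \<Longrightarrow> T v = c \<odot>\<^bsub>V\<^esub> v"
proof -
  interpret quandle_representation Q V \<rho>
    using irr by (simp add: irreducible_representation_def)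
  interpret complex_endomorphism V T by unfold_locales (rule hom)
  have invariant: "W = {\<zero>\<^bsub>V\<^esub>} \<or> W = carrier V"
    if "VectorSpace.subspace class_ring W V" "\<And>x w. \<lbrakk>x \<in> carrier Q; w \<in> W\<rbrakk> \<Longrightarrow> \<rho> x w \<in> W" for W
    using irr that by (simp add: irreducible_representation_def)
  have "\<exists>c. \<forall>v\<in>carrier V. T v = c \<odot>\<^bsub>V\<^esub> v"
  proof (cases "\<exists>c w. w \<in> carrier V \<and> w \<noteq> \<zero>\<^bsub>V\<^esub> \<and> T w = c \<odot>\<^bsub>V\<^esub> w")
    case True
    then obtain c w where w: "w \<in> carrier V" "w \<noteq> \<zero>\<^bsub>V\<^esub>" "T w = c \<odot>\<^bsub>V\<^esub> w" by blast
    \<comment> \<open>An eigenspace of an operator commuting with the representation is invariant,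
      and this one is nonzero.\<close>
    let ?E = "{w \<in> carrier V. T w = c \<odot>\<^bsub>V\<^esub> w}"
    have "?E = {\<zero>\<^bsub>V\<^esub>} \<or> ?E = carrier V"
      by (rule invariant, rule subspaceI)
        (auto simp: T_add T_smult comm rep_smult smult_simps mult.commute)
    then show ?thesis using w by blast
  next
    case False
    then have no_eigen: "w = \<zero>\<^bsub>V\<^esub>" if "w \<in> carrier V" "T w = c \<odot>\<^bsub>V\<^esub> w" for c w
      using that by blast
    show ?thesis
    \<comment> \<open>The zero space satisfies the definition of irreducibility; there any scalar
      serves.\<close>
    proof (cases "carrier V = {\<zero>\<^bsub>V\<^esub>}")
      case True
      then show ?thesis by (auto simp: smult_simps)
    next
      case False
      then obtain v where v: "v \<in> carrier V" "v \<noteq> \<zero>\<^bsub>V\<^esub>" by blast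
      have "\<exists>u\<in>carrier V. T u \<oplus>\<^bsub>V\<^esub> (- c) \<odot>\<^bsub>V\<^esub> u = v" for c
      proof -
        \<comment> \<open>The range of \<open>T - c\<close> is invariant and nonzero, as
          \<open>c\<close> is not an eigenvalue. Hence \<open>T - c\<close> is onto, and
          \<open>u c\<close> is chosen as a preimage of \<open>v\<close>.\<close>
        let ?D = "\<lambda>u. T u \<oplus>\<^bsub>V\<^esub> (- c) \<odot>\<^bsub>V\<^esub> u"
        have "?D ` carrier V = {\<zero>\<^bsub>V\<^esub>} \<or> ?D ` carrier V = carrier V"
        proof (rule invariant, rule subspaceI)
          show "\<zero>\<^bsub>V\<^esub> \<in> ?D ` carrier V"
            by (rule image_eqI[of _ _ "\<zero>\<^bsub>V\<^esub>"]) (auto simp: smult_simps(6))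
        next
          fix x y assume "x \<in> ?D ` carrier V" "y \<in> ?D ` carrier V"
          then obtain a b where ab: "a \<in> carrier V" "b \<in> carrier V" "x = ?D a" "y = ?D b" by blast
          then have "x \<oplus>\<^bsub>V\<^esub> y = ?D (a \<oplus>\<^bsub>V\<^esub> b)"
            by (simp add: T_add smult_simps M.a_ac)
          then show "x \<oplus>\<^bsub>V\<^esub> y \<in> ?D ` carrier V" using ab by blast
        next
          fix k x assume "x \<in> ?D ` carrier V"
          then obtain a where a: "a \<in> carrier V" "x = ?D a" by blast
          then have "k \<odot>\<^bsub>V\<^esub> x = ?D (k \<odot>\<^bsub>V\<^esub> a)"
            by (simp add: T_smult smult_simps mult.commute)
          then show "k \<odot>\<^bsub>V\<^esub> x \<in> ?D ` carrier V" using a by blast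
        next
          fix q x assume q: "q \<in> carrier Q" and "x \<in> ?D ` carrier V"
          then obtain a where a: "a \<in> carrier V" "x = ?D a" by blast
          then have "\<rho> q x = ?D (\<rho> q a)"
            using q by (simp add: rep_add rep_smult comm)
          then show "\<rho> q x \<in> ?D ` carrier V" using a q by blast
        qed auto
        moreover have "?D v \<noteq> \<zero>\<^bsub>V\<^esub>" using no_eigen[of v c] v eigen_iff[of v c] by blast
        ultimately have "?D ` carrier V = carrier V" using v by blast
        then show ?thesis using v by (metis (no_types, lifting) imageE)
      qed
      then obtain u where u: "\<And>c. u c \<in> carrier V" "\<And>c. T (u c) \<oplus>\<^bsub>V\<^esub> (- c) \<odot>\<^bsub>V\<^esub> u c = v"
        by metis
      have Tu: "T (u c) = v \<oplus>\<^bsub>V\<^esub> c \<odot>\<^bsub>V\<^esub> u c" for c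
      proof -
        have "v \<oplus>\<^bsub>V\<^esub> c \<odot>\<^bsub>V\<^esub> u c = T (u c) \<oplus>\<^bsub>V\<^esub> (- c + c) \<odot>\<^bsub>V\<^esub> u c"
          using u(1) by (subst u(2)[of c, symmetric]) (simp add: M.a_assoc smult_simps(1)[OF u(1)[of c], symmetric])
        then show ?thesis using u(1) by (simp add: smult_simps(5)[OF u(1)])
      qed
      let ?S = "(\<lambda>xs. foldr \<rho> xs v) ` lists (carrier Q)"
      have "countable ?S" using countable by blast
      moreover have S: "?S \<subseteq> carrier V" "span ?S = carrier V"
        by (rule orbit_span_eq_carrier[OF invariant v]; assumption)+
      moreover have "a c = 0"
        if "finite F" "(\<Oplus>\<^bsub>V\<^esub>c\<in>F. a c \<odot>\<^bsub>V\<^esub> u c) = \<zero>\<^bsub>V\<^esub>" "c \<in> F" for F a c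
        using resolvent_vectors_independent[OF no_eigen v u(1) Tu that(1), where f = 0 and a = a] that(2,3) by auto
      ultimately have False
        using countable_span_no_uncountable_independent[of ?S u] u(1) by blast
      then show ?thesis ..
    qed
  qed
  then show ?thesis using that by blast
qed

section \<open>The standard representations\<close>

lemma primitive_root_nonzero:
  "primitive_root_of_unity d \<alpha> \<Longrightarrow> d > 0 \<Longrightarrow> \<alpha> \<noteq> 0"
  by (auto simp: primitive_root_of_unity_def power_0_left)

lemma primitive_root_power_inj:
  assumes "primitive_root_of_unity d \<alpha>" "j < d" "k < d" "\<alpha> ^ j = \<alpha> ^ k"
  shows "j = k"
  using assms(2-4)
proof (induction j k rule: linorder_wlog)
  case (le j k)
  have "\<alpha> \<noteq> 0" using primitive_root_nonzero assms(1) le by simp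
  then have "\<alpha> ^ (k - j) = 1" using le by (simp add: power_diff)
  moreover have "k - j < d" using le by simp
  ultimately have "\<not> 0 < k - j" using assms(1) by (metis primitive_root_of_unity_def)
  then show ?case using le by simp
qed auto

lemma power_mod_dvd:
  fixes \<alpha> :: "'a :: monoid_mult"
  assumes "\<alpha> ^ d = 1" "d dvd n"
  shows "\<alpha> ^ (k mod n) = \<alpha> ^ k"
proof -
  have "\<alpha> ^ n = 1" using assms by (auto simp: power_mult)
  then have "\<alpha> ^ k = \<alpha> ^ (n * (k div n)) * \<alpha> ^ (k mod n)" by (metis power_add mult_div_mod_eq)
  then show ?thesis using \<open>\<alpha> ^ n = 1\<close> by (simp add: power_mult)
qed

text \<open>Since \<open>d > 1\<close> divides \<open>n\<close> and \<open>m\<close>, both exceed 1,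
  so \<open>X 1\<close> and \<open>Y 1\<close> are elements of \<open>Qnm n m\<close>.\<close>

lemma rho_parametersD:
  assumes "rho_parameters n m d \<alpha> l \<beta>"
  shows "d > 1" "\<alpha> \<noteq> 0" "\<alpha> ^ d = 1" "l \<noteq> 0" "\<beta> \<noteq> 0"
    and "n \<ge> 1 \<Longrightarrow> 1 < n" "m \<ge> 1 \<Longrightarrow> 1 < m"
  using assms primitive_root_nonzero[of d \<alpha>]
  by (auto simp: rho_parameters_def primitive_root_of_unity_def dest: dvd_imp_le)

lemma sum_eq_single:
  assumes "finite A" "j \<in> A" "\<And>i. \<lbrakk>i \<in> A; i \<noteq> j\<rbrakk> \<Longrightarrow> f i = 0"
  shows "sum f A = f j"
  using assms by (subst sum.mono_neutral_right[of A "{j}"]) auto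

section \<open>The standard representations in coordinates\<close>

lemma A_mat_mult_index:
  assumes "v \<in> carrier_vec d" "k < d"
  shows "(A_mat d \<alpha> \<beta> *\<^sub>v v) $ k = \<beta> * \<alpha> powi (- int k) * v $ k"
proof -
  have "(A_mat d \<alpha> \<beta> *\<^sub>v v) $ k = (\<Sum>j<d. A_mat d \<alpha> \<beta> $$ (k, j) * v $ j)"
    using assms by (simp add: A_mat_def mat_diag_def scalar_prod_def atLeast0LessThan)
  also have "\<dots> = A_mat d \<alpha> \<beta> $$ (k, k) * v $ k"
    using assms by (intro sum_eq_single) (auto simp: A_mat_def mat_diag_def)
  finally show ?thesis using assms by (simp add: A_mat_def mat_diag_def)
qed

lemma B_mat_mult_index:
  assumes "v \<in> carrier_vec d" "k < d"
  shows "(B_mat d l *\<^sub>v v) $ k = (if k = 0 then l * v $ (d - 1) else v $ (k - 1))"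
proof -
  define j where "j = (if k = 0 then d - 1 else k - 1)"
  have "(B_mat d l *\<^sub>v v) $ k = (\<Sum>j<d. B_mat d l $$ (k, j) * v $ j)"
    using assms by (simp add: B_mat_def scalar_prod_def atLeast0LessThan)
  also have "\<dots> = B_mat d l $$ (k, j) * v $ j"
    using assms by (intro sum_eq_single) (auto simp: B_mat_def j_def)
  finally show ?thesis using assms by (auto simp: B_mat_def j_def)
qed

lemma mat_dims [simp]:
  "A_mat d \<alpha> \<beta> \<in> carrier_mat d d" "B_mat d l \<in> carrier_mat d d" "rho_mat d \<alpha> l \<beta> q \<in> carrier_mat d d"
proof -
  show *: "A_mat d \<alpha> \<beta> \<in> carrier_mat d d" "B_mat d l \<in> carrier_mat d d"
    by (auto simp: A_mat_def B_mat_def mat_diag_def)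
  show "rho_mat d \<alpha> l \<beta> q \<in> carrier_mat d d" by (cases q) (use * in auto)
qed

lemma smult_mat_mult_vec:
  fixes M :: "'a :: comm_semiring_0 mat"
  assumes "M \<in> carrier_mat nr nc" "v \<in> carrier_vec nc"
  shows "(c \<cdot>\<^sub>m M) *\<^sub>v v = c \<cdot>\<^sub>v (M *\<^sub>v v)"
  using assms by (intro eq_vecI) (auto simp: scalar_prod_def sum_distrib_left mult.assoc)

lemma rho_closed [simp, intro]: "v \<in> carrier_vec d \<Longrightarrow> rho d \<alpha> l \<beta> q v \<in> carrier_vec d"
  by (simp add: rho_def mult_mat_vec_carrier[OF mat_dims(3)])

lemma dim_rho [simp]: "v \<in> carrier_vec d \<Longrightarrow> dim_vec (rho d \<alpha> l \<beta> q v) = d"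
  using rho_closed carrier_vecD by blast

text \<open>All later computations with \<open>rho\<close> go through these coordinates. Integer
  powers are turned into quotients of natural powers, which suit \<open>field_simps\<close>.\<close>

lemma rho_index:
  assumes "\<alpha> \<noteq> 0" "v \<in> carrier_vec d" "k < d"
  shows "rho d \<alpha> l \<beta> (X i) v $ k = \<alpha> ^ i / \<alpha> * (\<beta> / \<alpha> ^ k) * v $ k"
    and "rho d \<alpha> l \<beta> (Y j) v $ k = \<alpha> / \<alpha> ^ j * (if k = 0 then l * v $ (d - 1) else v $ (k - 1))"
proof -
  have "rho d \<alpha> l \<beta> (X i) v $ k = \<alpha> powi (int i - 1) * (A_mat d \<alpha> \<beta> *\<^sub>v v) $ k"
    using assms mat_dims(1)[of d \<alpha> \<beta>, THEN carrier_matD(1)]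
    by (simp add: rho_def carrier_matD smult_mat_mult_vec[OF mat_dims(1) assms(2)])
  then show "rho d \<alpha> l \<beta> (X i) v $ k = \<alpha> ^ i / \<alpha> * (\<beta> / \<alpha> ^ k) * v $ k"
    using assms by (simp add: A_mat_mult_index power_int_diff power_int_minus field_simps)
  have "rho d \<alpha> l \<beta> (Y j) v $ k = \<alpha> powi (1 - int j) * (B_mat d l *\<^sub>v v) $ k"
    using assms mat_dims(2)[of d l, THEN carrier_matD(1)]
    by (simp add: rho_def carrier_matD smult_mat_mult_vec[OF mat_dims(2) assms(2)])
  then show "rho d \<alpha> l \<beta> (Y j) v $ k = \<alpha> / \<alpha> ^ j * (if k = 0 then l * v $ (d - 1) else v $ (k - 1))"
    using assms by (simp add: B_mat_mult_index power_int_diff)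
qed

lemma rho_linear:
  assumes "v \<in> carrier_vec d" "w \<in> carrier_vec d"
  shows "rho d \<alpha> l \<beta> q (v + w) = rho d \<alpha> l \<beta> q v + rho d \<alpha> l \<beta> q w"
    and "rho d \<alpha> l \<beta> q (c \<cdot>\<^sub>v v) = c \<cdot>\<^sub>v rho d \<alpha> l \<beta> q v"
  using assms mult_add_distrib_mat_vec[OF mat_dims(3)] mult_mat_vec[OF mat_dims(3)]
  by (auto simp: rho_def)

lemma rho_funpow_closed [simp, intro]:
  "v \<in> carrier_vec d \<Longrightarrow> (rho d \<alpha> l \<beta> q ^^ k) v \<in> carrier_vec d"
  by (induction k) auto

text \<open>Every diagonal entry is \<open>\<beta>\<close> times a quotient of powers of
  \<open>\<alpha>\<close>, and these become 1 in the \<open>d\<close>-th power.\<close>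

lemma rho_X_funpow:
  assumes "\<alpha> \<noteq> 0" "\<alpha> ^ d = 1" "v \<in> carrier_vec d"
  shows "(rho d \<alpha> l \<beta> (X i) ^^ d) v = \<beta> ^ d \<cdot>\<^sub>v v"
proof -
  have "(rho d \<alpha> l \<beta> (X i) ^^ r) v $ k = (\<alpha> ^ i / \<alpha> * (\<beta> / \<alpha> ^ k)) ^ r * v $ k" if "k < d" for r k
    using assms that by (induction r) (simp_all add: rho_index mult_ac)
  moreover have "(\<alpha> ^ i / \<alpha> * (\<beta> / \<alpha> ^ k)) ^ d = \<beta> ^ d" for k
  proof -
    have "(\<alpha> ^ j) ^ d = 1" for j using assms(2) by (metis mult.commute power_mult power_one)
    then show ?thesis using assms(2) by (simp add: power_mult_distrib power_divide)
  qed
  ultimately show ?thesis using assms by (intro eq_vecI) auto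
qed

text \<open>The matrix is a weighted cyclic shift: in \<open>d\<close> steps every coordinate passes
  the factor \<open>l\<close> exactly once and returns to its place.\<close>

lemma rho_Y_funpow:
  assumes "\<alpha> \<noteq> 0" "\<alpha> ^ d = 1" "v \<in> carrier_vec d"
  shows "(rho d \<alpha> l \<beta> (Y j) ^^ d) v = l \<cdot>\<^sub>v v"
proof -
  \<comment> \<open>After \<open>r\<close> steps exactly the coordinates \<open>k < r\<close> hold
    entries that have wrapped around.\<close>
  have "(rho d \<alpha> l \<beta> (Y j) ^^ r) v $ k
      = (\<alpha> / \<alpha> ^ j) ^ r * (if k < r then l * v $ (d + k - r) else v $ (k - r))"
    if "k < d" "r \<le> d" for r k
    using that
  proof (induction r arbitrary: k)
    case (Suc r)
    have "(rho d \<alpha> l \<beta> (Y j) ^^ Suc r) v $ k = \<alpha> / \<alpha> ^ j *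
        (if k = 0 then l * (rho d \<alpha> l \<beta> (Y j) ^^ r) v $ (d - 1) else (rho d \<alpha> l \<beta> (Y j) ^^ r) v $ (k - 1))"
      using assms Suc.prems by (simp add: rho_index)
    also have "\<dots> = (\<alpha> / \<alpha> ^ j) ^ Suc r *
        (if k < Suc r then l * v $ (d + k - Suc r) else v $ (k - Suc r))"
    proof (cases "k = 0")
      case True
      then show ?thesis using Suc.IH[of "d - 1"] Suc.prems by simp
    next
      case False
      then show ?thesis using Suc.IH[of "k - 1"] Suc.prems by (auto simp: mult_ac)
    qed
    finally show ?case .
  qed simp
  moreover have "(\<alpha> / \<alpha> ^ j) ^ d = 1"
    using assms(2) by (metis div_by_1 mult.commute power_divide power_mult power_one)
  ultimately show ?thesis using assms by (intro eq_vecI) auto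
qed

text \<open>In the iterate, \<open>f\<close> is both the first and the last map applied: the former
  gives injectivity, the latter surjectivity.\<close>

lemma bij_betw_if_funpow_bij:
  assumes "f ` S \<subseteq> S" "bij_betw (f ^^ Suc k) S S"
  shows "bij_betw f S S"
proof (rule bij_betw_imageI)
  show "inj_on f S"
    using bij_betw_imp_inj_on[OF assms(2)] unfolding funpow_Suc_right by (rule inj_on_imageI2)
  have "(f ^^ r) x \<in> S" if "x \<in> S" for r x
    using assms(1) that by (induction r) auto
  then have "(f ^^ Suc k) ` S \<subseteq> f ` S" by auto
  then show "f ` S = S" using assms(1) bij_betw_imp_surj_on[OF assms(2)] by auto
qed

text \<open>The \<open>d\<close>-th iterate is multiplication by a nonzero scalar, hence
  bijective.\<close>

lemma rho_bij:
  assumes "\<alpha> \<noteq> 0" "\<alpha> ^ d = 1" "l \<noteq> 0" "\<beta> \<noteq> 0" "d > 0"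
  shows "bij_betw (rho d \<alpha> l \<beta> q) (carrier_vec d) (carrier_vec d)"
proof -
  obtain c where c: "c \<noteq> 0" "\<And>v. v \<in> carrier_vec d \<Longrightarrow> (rho d \<alpha> l \<beta> q ^^ d) v = c \<cdot>\<^sub>v v"
    using assms rho_X_funpow rho_Y_funpow by (cases q) (metis power_not_zero)+
  have "bij_betw (\<lambda>v. c \<cdot>\<^sub>v v) (carrier_vec d) (carrier_vec d)"
    using c(1) by (intro bij_betw_byWitness[of _ "\<lambda>v. inverse c \<cdot>\<^sub>v v"]) (auto simp: smult_smult_assoc)
  then have "bij_betw (rho d \<alpha> l \<beta> q ^^ d) (carrier_vec d) (carrier_vec d)"
    using c(2) by (simp cong: bij_betw_cong)
  then show ?thesis
    using bij_betw_if_funpow_bij[of "rho d \<alpha> l \<beta> q" "carrier_vec d" "d - 1"] assms(5) by auto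
qed

text \<open>The conjugation relation in a form without inverses, checked coordinate by coordinate.
  Reduction of indices modulo \<open>n\<close> or \<open>m\<close> is harmless because
  \<open>\<alpha>\<close> has order dividing both.\<close>

lemma rho_conj:
  assumes "rho_parameters n m d \<alpha> l \<beta>" "v \<in> carrier_vec d"
  shows "rho d \<alpha> l \<beta> (qnm_op n m x y) (rho d \<alpha> l \<beta> x v) = rho d \<alpha> l \<beta> x (rho d \<alpha> l \<beta> y v)"
proof -
  note p = rho_parametersD(1-5)[OF assms(1)]
  have mods: "\<alpha> ^ (k mod n) = \<alpha> ^ k" "\<alpha> ^ (k mod m) = \<alpha> ^ k" for k
    using assms(1) p(3) by (auto simp: rho_parameters_def intro: power_mod_dvd)
  \<comment> \<open>Used at coordinate 0, where the shift brings in the entry with index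
    \<open>d - 1\<close>.\<close>
  have d1: "\<alpha> * \<alpha> ^ (d - 1) = 1" using p(1,3) by (cases d) auto
  show ?thesis
  proof (rule eq_vecI)
    fix k assume "k < dim_vec (rho d \<alpha> l \<beta> x (rho d \<alpha> l \<beta> y v))"
    then have k: "k < d" 
      using rho_closed[OF rho_closed[OF assms(2)], THEN carrier_vecD] by simp
    obtain k' where k': "k = 0 \<or> k = Suc k'" by (metis not0_implies_Suc)
    show "rho d \<alpha> l \<beta> (qnm_op n m x y) (rho d \<alpha> l \<beta> x v) $ k = rho d \<alpha> l \<beta> x (rho d \<alpha> l \<beta> y v) $ k"
      using assms(2) k k' p d1
      by (cases x; cases y) (auto simp: rho_index[OF p(2)] mods power_Suc field_simps)
  qed (use assms(2) in \<open>metis carrier_vecD rho_closed\<close>)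
qed

section \<open>The standard maps as irreducible representations\<close>

lemma complex_space_simps:
  "carrier (complex_space d) = carrier_vec d" "\<zero>\<^bsub>complex_space d\<^esub> = 0\<^sub>v d"
  "v \<oplus>\<^bsub>complex_space d\<^esub> w = v + w" "c \<odot>\<^bsub>complex_space d\<^esub> v = c \<cdot>\<^sub>v v"
  by (simp_all add: module_vec_def)

lemma rho_hom: "rho d \<alpha> l \<beta> q \<in> LinearCombinations.module_hom class_ring (complex_space d) (complex_space d)"
  by (auto simp: LinearCombinations.module_hom_def complex_space_simps rho_linear)

lemma rho_representation:
  assumes "rho_parameters n m d \<alpha> l \<beta>"
  shows "quandle_representation (Qnm n m) (complex_space d) (rho d \<alpha> l \<beta>)"
proof -
  note p = rho_parametersD(1-5)[OF assms(1)]
  interpret vectorspace class_ring "complex_space d" by (rule vec_vs)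
  interpret G: group "GL (complex_space d)" by (rule group_GL) (rule vec_vs)
  let ?\<rho> = "rho d \<alpha> l \<beta>"
  have mem: "?\<rho> q \<in> carrier (GL (complex_space d))" for q
    using rho_bij[of \<alpha> d l \<beta> q] p rho_hom[of d \<alpha> l \<beta> q]
    by (auto simp: GL_def Bij_def complex_space_simps) (auto simp: rho_def)
  have conj: "?\<rho> (qnm_op n m x y) \<otimes>\<^bsub>GL (complex_space d)\<^esub> ?\<rho> x = ?\<rho> x \<otimes>\<^bsub>GL (complex_space d)\<^esub> ?\<rho> y" for x y
    using mem rho_conj[OF assms]
    by (auto simp: GL_def BijGroup_def compose_def complex_space_simps restrict_def)
  have "?\<rho> (qnm_op n m x y)
      = ?\<rho> x \<otimes>\<^bsub>GL (complex_space d)\<^esub> ?\<rho> y \<otimes>\<^bsub>GL (complex_space d)\<^esub> inv\<^bsub>GL (complex_space d)\<^esub> ?\<rho> x" for x y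
    using mem conj[of x y] by (intro G.inv_solve_right[THEN iffD2]) auto
  then show ?thesis
    by (intro quandle_representation.intro quandle_Qnm vec_vs quandle_representation_axioms.intro)
      (auto simp: mem Qnm_def)
qed

text \<open>The image of \<open>X 1\<close> is diagonal with distinct eigenvalues, so a nonzero
  invariant subspace contains a unit vector; the cyclic shift given by \<open>Y 1\<close> then
  reaches all the others.\<close>

lemma rho_invariant_subspace:
  assumes p: "rho_parameters n m d \<alpha> l \<beta>" and nm: "n \<ge> 1" "m \<ge> 1"
    and W: "VectorSpace.subspace class_ring W (complex_space d)"
    and inv: "\<And>x w. \<lbrakk>x \<in> carrier (Qnm n m); w \<in> W\<rbrakk> \<Longrightarrow> rho d \<alpha> l \<beta> x w \<in> W"
  shows "W = {0\<^sub>v d} \<or> W = carrier_vec d"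
proof (rule disjCI)
  note pp = rho_parametersD[OF p]
  interpret vec_space "TYPE(complex)" d .
  interpret W: submodule class_ring W "complex_space d" using W by (simp add: VectorSpace.subspace_def)
  have WV: "W \<subseteq> carrier_vec d" using W.subset by (simp add: complex_space_simps)
  have add: "v + w \<in> W" if "v \<in> W" "w \<in> W" for v w
    using W.m_closed[OF that] by (simp add: complex_space_simps)
  have smult: "c \<cdot>\<^sub>v w \<in> W" if "w \<in> W" for c w
    using W.smult_closed[of c w] that by (simp add: complex_space_simps)
  have zero: "0\<^sub>v d \<in> W" using W.zero_closed by (simp add: complex_space_simps)
  have X1: "X 1 \<in> carrier (Qnm n m)" and Y1: "Y 1 \<in> carrier (Qnm n m)"
    using pp(6,7) nm by (auto simp: Qnm_def)
  have root: "primitive_root_of_unity d \<alpha>" using p by (simp add: rho_parameters_def)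
  assume "W \<noteq> carrier_vec d"
  show "W = {0\<^sub>v d}"
  proof (rule ccontr)
    assume "W \<noteq> {0\<^sub>v d}"
    then obtain w where w: "w \<in> W" "w \<noteq> 0\<^sub>v d" using zero by blast
    then obtain k where k: "k < d" "w $ k \<noteq> 0" using WV by (metis carrier_vecD eq_vecI index_zero_vec subsetD)
    \<comment> \<open>The coordinates other than \<open>k\<close> are cleared one at a time.\<close>
    have "\<exists>u\<in>W. u $ k \<noteq> 0 \<and> (\<forall>j\<in>F. u $ j = 0)" if "finite F" "F \<subseteq> {..<d} - {k}" for F
      using that
    proof (induction F rule: finite_induct)
      case empty
      then show ?case using w k by blast
    next
      case (insert i F)
      then obtain u where u: "u \<in> W" "u $ k \<noteq> 0" "\<forall>j\<in>F. u $ j = 0" by auto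
      \<comment> \<open>Subtracting the \<open>i\<close>-th eigenvalue from the diagonal operator
        clears coordinate \<open>i\<close>, keeps the zeros already obtained, and multiplies
        coordinate \<open>k\<close> by a nonzero difference of eigenvalues.\<close>
      define u' where "u' = rho d \<alpha> l \<beta> (X 1) u + (- (\<beta> / \<alpha> ^ i)) \<cdot>\<^sub>v u"
      have ud: "u \<in> carrier_vec d" using u WV by blast
      have u': "u' $ j = \<beta> * (1 / \<alpha> ^ j - 1 / \<alpha> ^ i) * u $ j" if "j < d" for j
        using that ud pp(2) rho_closed[OF ud, THEN carrier_vecD]
        by (simp add: u'_def rho_index field_simps)
      have "u' \<in> W" unfolding u'_def by (intro add smult inv X1 u)
      moreover have "\<alpha> ^ k \<noteq> \<alpha> ^ i" using primitive_root_power_inj[OF root k(1), of i] insert.prems by auto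
      then have "u' $ k \<noteq> 0" using u' k u pp by simp
      moreover have "\<forall>j\<in>insert i F. u' $ j = 0" using u' u insert.prems by auto
      ultimately show ?case by blast
    qed
    from this[of "{..<d} - {k}"] obtain u where u: "u \<in> W" "u $ k \<noteq> 0" "\<forall>j\<in>{..<d} - {k}. u $ j = 0"
      by auto
    have "unit_vec d k = inverse (u $ k) \<cdot>\<^sub>v u"
      using u k WV by (intro eq_vecI) (auto simp: subset_iff)
    then have ek: "unit_vec d k \<in> W" using smult u by metis
    have step: "unit_vec d (Suc j mod d) \<in> W" if "unit_vec d j \<in> W" "j < d" for j
    proof -
      \<comment> \<open>For \<open>Y 1\<close> the scalar factor is
        \<open>\<alpha> powi 0\<close>.\<close>
      have rw: "rho d \<alpha> l \<beta> (Y 1) (unit_vec d j) = B_mat d l *\<^sub>v unit_vec d j"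
        by (simp add: rho_def) (intro arg_cong2[of _ _ _ _ mult_mat_vec] eq_matI, auto)
      show ?thesis
      proof (cases "j < d - 1")
        case True
        then have "rho d \<alpha> l \<beta> (Y 1) (unit_vec d j) = unit_vec d (Suc j mod d)"
          using B_mat_unit_vec(1)[OF pp(1) True] rw by simp
        then show ?thesis using inv[OF Y1 that(1)] by metis
      next
        case False
        then have j: "j = d - 1" using that by simp
        then have "rho d \<alpha> l \<beta> (Y 1) (unit_vec d j) = l \<cdot>\<^sub>v unit_vec d (Suc j mod d)"
          using B_mat_unit_vec(2)[OF pp(1)] rw pp(1) by simp
        then have "unit_vec d (Suc j mod d) = inverse l \<cdot>\<^sub>v rho d \<alpha> l \<beta> (Y 1) (unit_vec d j)"
          using pp(4) by (simp add: smult_smult_assoc)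
        then show ?thesis using smult[OF inv[OF Y1 that(1)]] by metis
      qed
    qed
    have shift: "unit_vec d ((k + s) mod d) \<in> W" for s
    proof (induction s)
      case (Suc s)
      then show ?case using step[of "(k + s) mod d"] pp(1) by (simp add: mod_Suc_eq)
    qed (use ek k in simp)
    \<comment> \<open>A shift by \<open>d - k + j\<close> carries index \<open>k\<close> to
      \<open>d + j\<close>, which is \<open>j\<close> modulo \<open>d\<close>, without subtracting
      below zero.\<close>
    have "unit_vec d j \<in> W" if "j < d" for j
      using shift[of "d - k + j"] k that by simp
    then have "set (unit_vecs d) \<subseteq> W" by (auto simp: unit_vecs_def)
    then have "span (set (unit_vecs d)) \<subseteq> W"
      by (rule span_is_subset[OF _ is_module[OF W]])
    then have "carrier_vec d \<subseteq> W" by (simp only: span_unit_vecs_is_carrier)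
    then show False using WV \<open>W \<noteq> carrier_vec d\<close> by blast
  qed
qed

lemma rho_irreducible:
  assumes "rho_parameters n m d \<alpha> l \<beta>" "n \<ge> 1" "m \<ge> 1"
  shows "irreducible_representation (Qnm n m) (complex_space d) (rho d \<alpha> l \<beta>)"
  unfolding irreducible_representation_def
proof (intro conjI allI impI rho_representation[OF assms(1)], elim conjE)
  fix W assume "VectorSpace.subspace class_ring W (complex_space d)"
    "\<forall>x\<in>carrier (Qnm n m). \<forall>w\<in>W. rho d \<alpha> l \<beta> x w \<in> W"
  then show "W = {\<zero>\<^bsub>complex_space d\<^esub>} \<or> W = carrier (complex_space d)"
    unfolding complex_space_simps by (intro rho_invariant_subspace[OF assms]) auto
qed

lemma dim_greater_one_complex_space: "d > 1 \<Longrightarrow> dim_greater_one (complex_space d)"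
proof -
  interpret vec_space "TYPE(complex)" d .
  show "d > 1 \<Longrightarrow> dim_greater_one (complex_space d)"
    by (simp add: dim_greater_one_def dim_is_n)
qed

section \<open>Equivalences\<close>

lemma linear_mapI:
  assumes "vectorspace K V" "vectorspace K W" "T \<in> LinearCombinations.module_hom K V W"
  shows "linear_map K V W T"
  using assms
  by (simp add: linear_map_def mod_hom_def mod_hom_axioms_def vectorspace_def)

lemma linear_map_module_hom: "linear_map K V W T \<Longrightarrow> T \<in> LinearCombinations.module_hom K V W"
  by (simp add: linear_map_def mod_hom_def mod_hom_axioms_def)

section \<open>Equivalence of representations as an equivalence relation\<close>

lemma equivalent_representations_refl:
  assumes "vectorspace class_ring V"
  shows "equivalent_representations Q V \<rho> V \<rho>"
  unfolding equivalent_representations_def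
  by (intro exI[of _ "\<lambda>v. v"] conjI linear_mapI assms)
    (auto simp: LinearCombinations.module_hom_def bij_betw_def)

lemma equivalent_representations_trans:
  assumes "equivalent_representations Q V \<rho> V' \<rho>'" "equivalent_representations Q V' \<rho>' V'' \<rho>''"
  shows "equivalent_representations Q V \<rho> V'' \<rho>''"
proof -
  obtain S where S: "linear_map class_ring V V' S" "bij_betw S (carrier V) (carrier V')"
      "\<forall>x\<in>carrier Q. \<forall>v\<in>carrier V. S (\<rho> x v) = \<rho>' x (S v)"
    using assms(1) unfolding equivalent_representations_def by blast
  obtain T where T: "linear_map class_ring V' V'' T" "bij_betw T (carrier V') (carrier V'')"
      "\<forall>x\<in>carrier Q. \<forall>v\<in>carrier V'. T (\<rho>' x v) = \<rho>'' x (T v)"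
    using assms(2) unfolding equivalent_representations_def by blast
  note hom = linear_map_module_hom[OF S(1)] linear_map_module_hom[OF T(1)]
  show ?thesis
    unfolding equivalent_representations_def
  proof (intro exI[of _ "\<lambda>v. T (S v)"] conjI linear_mapI)
    show "vectorspace class_ring V" "vectorspace class_ring V''"
      using S(1) T(1) by (auto simp: linear_map_def)
    show "(\<lambda>v. T (S v)) \<in> LinearCombinations.module_hom class_ring V V''"
      using hom by (auto simp: LinearCombinations.module_hom_def Pi_iff)
    show "bij_betw (\<lambda>v. T (S v)) (carrier V) (carrier V'')"
      using bij_betw_trans[OF S(2) T(2)] by (simp add: comp_def)
    show "\<forall>x\<in>carrier Q. \<forall>v\<in>carrier V. T (S (\<rho> x v)) = \<rho>'' x (T (S v))"
      using S(3) T(3) bij_betwE[OF S(2)] by simp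
  qed
qed

lemma equivalent_representations_sym:
  fixes V :: "(complex, 'v, 'w) module_scheme" and V' :: "(complex, 'v', 'w') module_scheme"
  assumes eq: "equivalent_representations Q V \<rho> V' \<rho>'"
    and closed: "\<And>x v. \<lbrakk>x \<in> carrier Q; v \<in> carrier V\<rbrakk> \<Longrightarrow> \<rho> x v \<in> carrier V"
  shows "equivalent_representations Q V' \<rho>' V \<rho>"
proof -
  obtain T where lin: "linear_map class_ring V V' T" and bij: "bij_betw T (carrier V) (carrier V')"
    and comm: "\<forall>x\<in>carrier Q. \<forall>v\<in>carrier V. T (\<rho> x v) = \<rho>' x (T v)"
    using eq unfolding equivalent_representations_def by blast
  interpret complex_vectorspace V using lin by (simp add: linear_map_def complex_vectorspace_def)
  note hom = linear_map_module_hom[OF lin, unfolded LinearCombinations.module_hom_def, simplified]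
  define S where "S = inv_into (carrier V) T"
  have S: "S w \<in> carrier V" "T (S w) = w" if "w \<in> carrier V'" for w
    using that bij by (auto simp: S_def bij_betw_def inv_into_into f_inv_into_f)
  have SI: "S w = v" if "v \<in> carrier V" "T v = w" for v w
    using that bij by (auto simp: S_def bij_betw_def)
  show ?thesis
    unfolding equivalent_representations_def
  proof (intro exI[of _ S] conjI linear_mapI)
    show "vectorspace class_ring V" "vectorspace class_ring V'"
      using lin by (auto simp: linear_map_def)
    show "S \<in> LinearCombinations.module_hom class_ring V' V"
      unfolding LinearCombinations.module_hom_def
      using hom S by (auto intro!: SI)
    show "bij_betw S (carrier V') (carrier V)"
      unfolding S_def by (rule bij_betw_inv_into[OF bij])
    show "\<forall>x\<in>carrier Q. \<forall>v\<in>carrier V'. S (\<rho>' x v) = \<rho> x (S v)"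
      using S comm closed by (auto intro!: SI)
  qed
qed

text \<open>Schur's lemma in its first form: kernel and image of an intertwiner are invariant, so a
  nonzero one has zero kernel and full image.\<close>

lemma irreducible_intertwiner_bij:
  fixes V :: "(complex, 'v, 'w) module_scheme" and V' :: "(complex, 'v', 'w') module_scheme"
  assumes irr: "irreducible_representation Q V \<rho>" "irreducible_representation Q V' \<rho>'"
    and lin: "linear_map class_ring V V' T"
    and comm: "\<And>x v. \<lbrakk>x \<in> carrier Q; v \<in> carrier V\<rbrakk> \<Longrightarrow> T (\<rho> x v) = \<rho>' x (T v)"
    and nonzero: "v \<in> carrier V" "T v \<noteq> \<zero>\<^bsub>V'\<^esub>"
  shows "bij_betw T (carrier V) (carrier V')"
proof -
  interpret T: linear_map class_ring V V' T by (rule lin)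
  interpret R: quandle_representation Q V \<rho>
    using irr(1) by (simp add: irreducible_representation_def)
  interpret R': quandle_representation Q V' \<rho>'
    using irr(2) by (simp add: irreducible_representation_def)
  have "T.ker = {\<zero>\<^bsub>V\<^esub>} \<or> T.ker = carrier V"
    using irr(1) T.kerT_is_subspace unfolding irreducible_representation_def
    by (auto simp: T.ker_def comm)
  then have "T.ker = {\<zero>\<^bsub>V\<^esub>}" using nonzero by (auto simp: T.ker_def)
  then have "inj_on T (carrier V)" by (intro T.Ke0_imp_inj) simp
  moreover have "T.im = {\<zero>\<^bsub>V'\<^esub>} \<or> T.im = carrier V'"
  proof -
    have "\<rho>' x w \<in> T.im" if xw: "x \<in> carrier Q" "w \<in> T.im" for x w
    proof -
      obtain v where v: "v \<in> carrier V" "w = T v" using xw(2) by (auto simp: T.im_def)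
      then have "\<rho>' x w = T (\<rho> x v)" using comm[OF xw(1)] by simp
      then show ?thesis using R.rep_vec_closed[OF xw(1) v(1)] by (simp add: T.im_def)
    qed
    then show ?thesis
      using irr(2) T.imT_is_subspace unfolding irreducible_representation_def by blast
  qed
  then have "T.im = carrier V'" using nonzero by (auto simp: T.im_def)
  ultimately show ?thesis by (simp add: bij_betw_def T.im_def)
qed

text \<open>The intertwiner is the image of \<open>Y 1\<close>, that is \<open>B\<close>. It
  commutes with every \<open>Y j\<close>, and \<open>B A = \<alpha> A B\<close> accounts for the
  change of \<open>\<beta>\<close>. The identity holds for all labels, so \<open>Q\<close> may be
  arbitrary.\<close>

lemma rho_equivalent_shift:
  assumes "rho_parameters n m d \<alpha> l \<beta>"
  shows "equivalent_representations Q (complex_space d) (rho d \<alpha> l \<beta>) (complex_space d) (rho d \<alpha> l (\<alpha> * \<beta>))"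
  unfolding equivalent_representations_def
proof (intro exI[of _ "rho d \<alpha> l \<beta> (Y 1)"] conjI linear_mapI vec_vs rho_hom ballI)
  note p = rho_parametersD[OF assms]
  show "bij_betw (rho d \<alpha> l \<beta> (Y 1)) (carrier (complex_space d)) (carrier (complex_space d))"
    using rho_bij p by (simp add: complex_space_simps)
  have d1: "\<alpha> * \<alpha> ^ (d - 1) = 1" using p(1,3) by (cases d) auto
  fix x v assume "v \<in> carrier (complex_space d)"
  then have v: "v \<in> carrier_vec d" by (simp add: complex_space_simps)
  show "rho d \<alpha> l \<beta> (Y 1) (rho d \<alpha> l \<beta> x v) = rho d \<alpha> l (\<alpha> * \<beta>) x (rho d \<alpha> l \<beta> (Y 1) v)"
  proof (rule eq_vecI)
    fix k assume "k < dim_vec (rho d \<alpha> l (\<alpha> * \<beta>) x (rho d \<alpha> l \<beta> (Y 1) v))"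
    then have k: "k < d"
      using rho_closed[OF rho_closed[OF v], THEN carrier_vecD] by simp
    obtain k' where k': "k = 0 \<or> k = Suc k'" by (metis not0_implies_Suc)
    show "rho d \<alpha> l \<beta> (Y 1) (rho d \<alpha> l \<beta> x v) $ k = rho d \<alpha> l (\<alpha> * \<beta>) x (rho d \<alpha> l \<beta> (Y 1) v) $ k"
      using v k k' p d1 by (cases x) (auto simp: rho_index[OF p(2)] field_simps)
  qed (use rho_closed[OF rho_closed[OF v], THEN carrier_vecD] in simp)
qed

lemma rho_equivalent_power:
  assumes "rho_parameters n m d \<alpha> l \<beta>"
  shows "equivalent_representations Q (complex_space d) (rho d \<alpha> l \<beta>) (complex_space d) (rho d \<alpha> l (\<alpha> ^ s * \<beta>))"
proof (induction s)
  case 0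
  show ?case by (simp add: equivalent_representations_refl vec_vs)
next
  case (Suc s)
  have "rho_parameters n m d \<alpha> l (\<alpha> ^ s * \<beta>)"
    using assms rho_parametersD(2)[OF assms] by (simp add: rho_parameters_def)
  from equivalent_representations_trans[OF Suc.IH rho_equivalent_shift[OF this]]
  show ?case by (simp add: mult.assoc)
qed

text \<open>Reducing the exponent modulo \<open>d\<close> makes it non-negative, so every integer
  power is reached by iterating the shift above.\<close>

lemma root_of_unity_powi_eq_power:
  fixes \<alpha> :: "'a :: field"
  assumes "\<alpha> ^ d = 1" "d > 0"
  obtains s :: nat where "\<alpha> powi i = \<alpha> ^ s"
proof
  have "\<alpha> \<noteq> 0" using assms by (auto simp: power_0_left)
  have "\<alpha> powi i = \<alpha> powi (int d * (i div int d) + i mod int d)" by simp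
  also have "\<dots> = (\<alpha> powi int d) powi (i div int d) * \<alpha> powi (i mod int d)"
    using \<open>\<alpha> \<noteq> 0\<close> by (subst power_int_add) (simp_all only: power_int_mult simp_thms)
  also have "\<dots> = \<alpha> powi int (nat (i mod int d))" using assms by simp
  finally have "\<alpha> powi i = \<alpha> powi int (nat (i mod int d))" .
  then show "\<alpha> powi i = \<alpha> ^ nat (i mod int d)" by (simp only: power_int_of_nat)
qed

text \<open>Each parameter is read off an identity that an intertwiner preserves: the ratio of the
  operators at \<open>X 1\<close> and \<open>X 0\<close> gives \<open>\<alpha>\<close>, the
  \<open>d\<close>-th power of the operator at \<open>Y 1\<close> gives \<open>l\<close>, and an
  eigenvalue at \<open>X 1\<close> gives \<open>\<beta>\<close> up to powers of
  \<open>\<alpha>\<close>.\<close>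

lemma rho_equivalent_iff:
  assumes p: "rho_parameters n m d \<alpha> l \<beta>" and p': "rho_parameters n m d' \<alpha>' l' \<beta>'"
    and nm: "n \<ge> 1" "m \<ge> 1"
  shows "equivalent_representations (Qnm n m)
      (complex_space d) (rho d \<alpha> l \<beta>) (complex_space d') (rho d' \<alpha>' l' \<beta>')
    \<longleftrightarrow> \<alpha> = \<alpha>' \<and> l = l' \<and> (\<exists>i::int. \<beta> = \<beta>' * \<alpha> powi i)"
    (is "?L \<longleftrightarrow> ?R")
proof -
  note P = rho_parametersD[OF p] and P' = rho_parametersD[OF p']
  have prim: "primitive_root_of_unity d \<alpha>" "primitive_root_of_unity d' \<alpha>'"
    using p p' by (auto simp: rho_parameters_def)
  \<comment> \<open>The dimension is the order of the root of unity.\<close>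
  have deq: "d = d'" if "\<alpha> = \<alpha>'"
  proof -
    have "\<not> d < d'" "\<not> d' < d"
      using prim P(1) P'(1) that unfolding primitive_root_of_unity_def by auto
    then show ?thesis by simp
  qed
  show ?thesis
  proof
    assume ?L
    then obtain T where lin: "linear_map class_ring (complex_space d) (complex_space d') T"
      and bij: "bij_betw T (carrier_vec d) (carrier_vec d')"
      and comm: "\<And>x v. \<lbrakk>x \<in> carrier (Qnm n m); v \<in> carrier_vec d\<rbrakk>
        \<Longrightarrow> T (rho d \<alpha> l \<beta> x v) = rho d' \<alpha>' l' \<beta>' x (T v)"
      unfolding equivalent_representations_def complex_space_simps by blast
    have T: "T v \<in> carrier_vec d'" "T (c \<cdot>\<^sub>v v) = c \<cdot>\<^sub>v T v" if "v \<in> carrier_vec d" for c v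
      using linear_map_module_hom[OF lin] that
      by (auto simp: LinearCombinations.module_hom_def complex_space_simps)
    have Q: "X 0 \<in> carrier (Qnm n m)" "X 1 \<in> carrier (Qnm n m)" "Y 1 \<in> carrier (Qnm n m)"
      using P(6,7) nm by (auto simp: Qnm_def)
    have X01: "rho d \<alpha> l \<beta> (X 1) v = \<alpha> \<cdot>\<^sub>v rho d \<alpha> l \<beta> (X 0) v"
      if "\<alpha> \<noteq> 0" "v \<in> carrier_vec d" for d \<alpha> l \<beta> v
      using that by (intro eq_vecI) (simp_all add: rho_index)
    \<comment> \<open>The vector \<open>w\<close> is chosen with first unit vector as image, so that
      scalars in front of \<open>T w\<close> can be compared at coordinate 0.\<close>
    have nz: "unit_vec d' 0 \<in> carrier_vec d'" "unit_vec d' 0 $ 0 = (1::complex)" using P'(1) by auto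
    then obtain w where w: "w \<in> carrier_vec d" "T w = unit_vec d' 0"
      using bij_betw_imp_surj_on[OF bij] by (metis imageE)
    have "bij_betw (rho d \<alpha> l \<beta> (X 0)) (carrier_vec d) (carrier_vec d)"
      using rho_bij P by simp
    from bij_betw_imp_surj_on[OF this]
    obtain v where v: "v \<in> carrier_vec d" "rho d \<alpha> l \<beta> (X 0) v = w"
      using w(1) by (metis imageE)
    have "\<alpha> \<cdot>\<^sub>v T w = T (rho d \<alpha> l \<beta> (X 1) v)"
      using X01[OF P(2) v(1)] v(2) T(2)[OF w(1)] by simp
    also have "\<dots> = \<alpha>' \<cdot>\<^sub>v rho d' \<alpha>' l' \<beta>' (X 0) (T v)"
      using comm[OF Q(2) v(1)] X01[OF P'(2) T(1)[OF v(1)]] by simp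
    also have "\<dots> = \<alpha>' \<cdot>\<^sub>v T w" using comm[OF Q(1) v(1)] v(2) by simp
    finally have "(\<alpha> \<cdot>\<^sub>v T w) $ 0 = (\<alpha>' \<cdot>\<^sub>v T w) $ 0" by simp
    then have \<alpha>: "\<alpha> = \<alpha>'" using w(2) P'(1) by simp
    then have d: "d = d'" by (rule deq)
    have "T ((rho d \<alpha> l \<beta> (Y 1) ^^ k) w) = (rho d' \<alpha>' l' \<beta>' (Y 1) ^^ k) (T w)" for k
    proof (induction k)
      case (Suc k)
      then show ?case
        using comm[OF Q(3) rho_funpow_closed[OF w(1), where q = "Y 1" and \<alpha> = \<alpha> and l = l and \<beta> = \<beta> and k = k]] by simp
    qed simp
    from this[of d] have "l \<cdot>\<^sub>v T w = l' \<cdot>\<^sub>v T w"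
      using rho_Y_funpow[OF P(2,3) w(1)] rho_Y_funpow[OF P'(2,3) T(1)[OF w(1)]] T(2)[OF w(1)] d by simp
    then have "(l \<cdot>\<^sub>v T w) $ 0 = (l' \<cdot>\<^sub>v T w) $ 0" by simp
    then have l: "l = l'" using w(2) P'(1) by simp
    \<comment> \<open>The first unit vector has eigenvalue \<open>\<beta>\<close> under
      \<open>X 1\<close>. Its image is an eigenvector of a diagonal matrix, so
      \<open>\<beta>\<close> is one of the diagonal entries there.\<close>
    let ?e = "unit_vec d 0 :: complex vec"
    have e: "?e \<in> carrier_vec d" by simp
    have "rho d \<alpha> l \<beta> (X 1) ?e = \<beta> \<cdot>\<^sub>v ?e"
      using P e by (intro eq_vecI) (auto simp: rho_index)
    then have eig: "rho d' \<alpha>' l' \<beta>' (X 1) (T ?e) = \<beta> \<cdot>\<^sub>v T ?e"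
      using comm[OF Q(2) e] T(2)[OF e] by simp
    have "T ?e \<noteq> 0\<^sub>v d'"
    proof
      assume "T ?e = 0\<^sub>v d'"
      moreover have "0 \<cdot>\<^sub>v 0\<^sub>v d' = (0\<^sub>v d' :: complex vec)" by (intro eq_vecI) auto
      ultimately have "T ?e = T (0 \<cdot>\<^sub>v ?e)" using T(2)[OF e] by simp
      then have "?e = 0 \<cdot>\<^sub>v ?e"
        using inj_onD[OF bij_betw_imp_inj_on[OF bij], of ?e "0 \<cdot>\<^sub>v ?e"] by simp
      then have "(?e $ 0 :: complex) = (0 \<cdot>\<^sub>v ?e) $ 0" by simp
      then show False using P(1) by simp
    qed
    then obtain k where k: "k < d'" "T ?e $ k \<noteq> 0"
      using T(1)[OF e] by (metis carrier_vecD eq_vecI index_zero_vec)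
    have "\<beta>' / \<alpha>' ^ k * T ?e $ k = \<beta> * T ?e $ k"
      using arg_cong[OF eig, of "\<lambda>v. v $ k"] k(1) T(1)[OF e] P'(2) by (simp add: rho_index)
    then have "\<beta> = \<beta>' * \<alpha> powi (- int k)"
      using k(2) \<alpha> P'(2) by (simp add: power_int_minus field_simps)
    then show ?R using \<alpha> l by blast
  next
    assume ?R
    then obtain i :: int where i: "\<alpha> = \<alpha>'" "l = l'" "\<beta> = \<beta>' * \<alpha> powi i" by blast
    \<comment> \<open>The exponent is \<open>- i\<close> because the shift multiplies
      \<open>\<beta>\<close>, and it has to arrive at \<open>\<beta>'\<close>.\<close>
    obtain s where s: "\<alpha> powi (- i) = \<alpha> ^ s"
      using root_of_unity_powi_eq_power[of \<alpha> d "- i"] P(1,3) by auto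
    have \<beta>': "\<alpha> ^ s * \<beta> = \<beta>'"
      using i(3) P(2) by (simp add: s[symmetric] power_int_minus field_simps)
    show ?L
      using rho_equivalent_power[OF p, of "Qnm n m" s] unfolding \<beta>' by (simp only: deq[OF i(1)] i(1,2))
  qed
qed

section \<open>Classification\<close>

text \<open>Here \<open>A i\<close> and \<open>B j\<close> stand for the images of \<open>X\<close>
  and \<open>Y\<close>, continued periodically to all natural indices, so that wrap-around
  disappears. The relations separate the two indices, and \<open>K\<close> is the common quotient.
  It commutes with the \<open>A i\<close> because \<open>A 1\<close> and \<open>A 1 K = A 0\<close>
  both do, and likewise with the \<open>B j\<close> because \<open>B 0\<close> and
  \<open>K B 0 = B 1\<close> do.\<close>

lemma (in group) twisted_commuting_families:
  fixes A B :: "nat \<Rightarrow> 'a"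
  assumes closed: "\<And>i. A i \<in> carrier G" "\<And>j. B j \<in> carrier G"
    and AA: "\<And>i j. A i \<otimes> A j = A j \<otimes> A i" and BB: "\<And>i j. B i \<otimes> B j = B j \<otimes> B i"
    and BA: "\<And>i j. B j \<otimes> A i = A (Suc i) \<otimes> B j" and AB: "\<And>i j. A i \<otimes> B j = B (Suc j) \<otimes> A i"
  shows "\<exists>K\<in>carrier G. (\<forall>i. A i = A (Suc i) \<otimes> K \<and> K \<otimes> A i = A i \<otimes> K) \<and>
    (\<forall>j. B (Suc j) = K \<otimes> B j \<and> K \<otimes> B j = B j \<otimes> K)"
proof -
  have key: "A i \<otimes> B j = A (Suc i) \<otimes> B (Suc j)" for i j
    using AB[of i j] BA[of "Suc j" i] by simp
  have A_quotient: "A i = A (Suc i) \<otimes> (B (Suc j) \<otimes> inv (B j))" for i j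
  proof -
    have "A i = A (Suc i) \<otimes> B (Suc j) \<otimes> inv (B j)"
      using closed key[of i j] by (intro inv_solve_right[THEN iffD2]) auto
    then show ?thesis using closed by (simp add: m_assoc)
  qed
  define K where "K = B 1 \<otimes> inv (B 0)"
  have K: "K \<in> carrier G" using closed by (simp add: K_def)
  have AK: "A i = A (Suc i) \<otimes> K" for i using A_quotient[of i 0] by (simp add: K_def)
  have "A 1 \<otimes> K = A 1 \<otimes> (B (Suc j) \<otimes> inv (B j))" for j
    using A_quotient[of 0 j] AK[of 0] by simp
  \<comment> \<open>Cancelling \<open>A 1\<close> shows that the quotient of consecutive
    \<open>B\<close> does not depend on \<open>j\<close>.\<close>
  then have K_eq: "K = B (Suc j) \<otimes> inv (B j)" for j
    using closed K by simp
  have BK: "B (Suc j) = K \<otimes> B j" for j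
    unfolding K_eq[of j] using closed by (simp add: m_assoc)
  have "A 1 \<otimes> (K \<otimes> A i) = A 1 \<otimes> (A i \<otimes> K)" for i
  proof -
    have "A 1 \<otimes> (K \<otimes> A i) = A (Suc 0) \<otimes> K \<otimes> A i" using closed K by (simp add: m_assoc)
    also have "\<dots> = A i \<otimes> A 0" by (simp only: AK[of 0, symmetric] AA[of 0 i])
    also have "\<dots> = A i \<otimes> A 1 \<otimes> K"
      using closed K by (subst AK[of 0]) (simp add: m_assoc)
    also have "\<dots> = A 1 \<otimes> A i \<otimes> K" by (simp only: AA[of i 1])
    also have "\<dots> = A 1 \<otimes> (A i \<otimes> K)" using closed K by (simp add: m_assoc)
    finally show ?thesis .
  qed
  then have KA: "K \<otimes> A i = A i \<otimes> K" for i
    using closed K by simp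
  have "K \<otimes> B j \<otimes> B 0 = B j \<otimes> K \<otimes> B 0" for j
  proof -
    have "K \<otimes> B j \<otimes> B 0 = K \<otimes> (B j \<otimes> B 0)" using closed K by (simp add: m_assoc)
    also have "\<dots> = K \<otimes> B 0 \<otimes> B j" using closed K by (simp add: m_assoc BB[of j 0])
    also have "\<dots> = B j \<otimes> B (Suc 0)" by (simp only: BK[of 0, symmetric] BB[of "Suc 0" j])
    also have "\<dots> = B j \<otimes> K \<otimes> B 0" unfolding BK[of 0] using closed K by (simp add: m_assoc)
    finally show ?thesis .
  qed
  then have KB: "K \<otimes> B j = B j \<otimes> K" for j
    using closed K by simp
  show ?thesis using K AK BK KA KB by blast
qed

section \<open>From relations in the general linear group to operators\<close>

lemma (in complex_endomorphism) funpow_hom: "T ^^ k \<in> LinearCombinations.module_hom class_ring V V"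
  by (induction k) (auto simp: LinearCombinations.module_hom_def class_ring_simps T_add T_smult)

lemma (in quandle_representation) GL_mult_apply:
  assumes "f \<in> carrier (GL V)" "g \<in> carrier (GL V)" "v \<in> carrier V"
  shows "(f \<otimes>\<^bsub>GL V\<^esub> g) v = f (g v)"
  using assms by (simp add: GL_def BijGroup_def compose_def)

lemma (in quandle_representation) rep_conj':
  assumes "x \<in> carrier Q" "y \<in> carrier Q"
  shows "\<rho> x \<otimes>\<^bsub>GL V\<^esub> \<rho> y = \<rho> (x \<triangleright>\<^bsub>Q\<^esub> y) \<otimes>\<^bsub>GL V\<^esub> \<rho> x"
proof -
  interpret G: group "GL V" by (rule group_GL) (rule vectorspace_axioms)
  show ?thesis
    using rep_closed[OF assms(1)] rep_closed[OF assms(2)] rep_conj[OF assms] by (simp add: G.m_assoc)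
qed

text \<open>The element \<open>\<rho>(y\<^sub>1) \<rho>(y\<^sub>0)\<^sup>-\<^sup>1 = \<rho>(x\<^sub>1)\<^sup>-\<^sup>1 \<rho>(x\<^sub>0)\<close> commutes with the whole representation,
  hence is a scalar \<open>\<kappa>\<close>.\<close>

lemma irreducible_Qnm_scalar:
  assumes irr: "irreducible_representation (Qnm n m) V \<rho>" and nm: "n \<ge> 1" "m \<ge> 1"
  obtains \<kappa> where
    "\<And>i v. v \<in> carrier V \<Longrightarrow> \<rho> (X (i mod n)) v = \<kappa> \<odot>\<^bsub>V\<^esub> \<rho> (X (Suc i mod n)) v"
    "\<And>j v. v \<in> carrier V \<Longrightarrow> \<rho> (Y (Suc j mod m)) v = \<kappa> \<odot>\<^bsub>V\<^esub> \<rho> (Y (j mod m)) v"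
proof -
  interpret quandle_representation "Qnm n m" V \<rho>
    using irr by (simp add: irreducible_representation_def)
  interpret G: group "GL V" by (rule group_GL) (rule vectorspace_axioms)
  have XQ: "X (i mod n) \<in> carrier (Qnm n m)" and YQ: "Y (i mod m) \<in> carrier (Qnm n m)" for i
    using nm by (auto simp: Qnm_def)
  have op: "x \<triangleright>\<^bsub>Qnm n m\<^esub> y = qnm_op n m x y" for x y by (simp add: Qnm_def)
  have "\<exists>K\<in>carrier (GL V).
      (\<forall>i. \<rho> (X (i mod n)) = \<rho> (X (Suc i mod n)) \<otimes>\<^bsub>GL V\<^esub> K \<and>
        K \<otimes>\<^bsub>GL V\<^esub> \<rho> (X (i mod n)) = \<rho> (X (i mod n)) \<otimes>\<^bsub>GL V\<^esub> K) \<and>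
      (\<forall>j. \<rho> (Y (Suc j mod m)) = K \<otimes>\<^bsub>GL V\<^esub> \<rho> (Y (j mod m)) \<and>
        K \<otimes>\<^bsub>GL V\<^esub> \<rho> (Y (j mod m)) = \<rho> (Y (j mod m)) \<otimes>\<^bsub>GL V\<^esub> K)"
  proof (rule G.twisted_commuting_families[of "\<lambda>i. \<rho> (X (i mod n))" "\<lambda>j. \<rho> (Y (j mod m))"])
    show "\<rho> (X (i mod n)) \<in> carrier (GL V)" "\<rho> (Y (i mod m)) \<in> carrier (GL V)" for i
      using rep_closed XQ YQ by blast+
    show "\<rho> (X (i mod n)) \<otimes>\<^bsub>GL V\<^esub> \<rho> (X (j mod n)) = \<rho> (X (j mod n)) \<otimes>\<^bsub>GL V\<^esub> \<rho> (X (i mod n))" for i j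
      using rep_conj'[OF XQ XQ, of i j] by (simp add: op)
    show "\<rho> (Y (i mod m)) \<otimes>\<^bsub>GL V\<^esub> \<rho> (Y (j mod m)) = \<rho> (Y (j mod m)) \<otimes>\<^bsub>GL V\<^esub> \<rho> (Y (i mod m))" for i j
      using rep_conj'[OF YQ YQ, of i j] by (simp add: op)
    show "\<rho> (Y (j mod m)) \<otimes>\<^bsub>GL V\<^esub> \<rho> (X (i mod n)) = \<rho> (X (Suc i mod n)) \<otimes>\<^bsub>GL V\<^esub> \<rho> (Y (j mod m))" for i j
      using rep_conj'[OF YQ XQ, of j i] by (simp add: op mod_Suc_eq)
    show "\<rho> (X (i mod n)) \<otimes>\<^bsub>GL V\<^esub> \<rho> (Y (j mod m)) = \<rho> (Y (Suc j mod m)) \<otimes>\<^bsub>GL V\<^esub> \<rho> (X (i mod n))" for i j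
      using rep_conj'[OF XQ YQ, of i j] by (simp add: op mod_Suc_eq)
  qed
  then obtain K where K_closed: "K \<in> carrier (GL V)"
    and KX: "\<forall>i. \<rho> (X (i mod n)) = \<rho> (X (Suc i mod n)) \<otimes>\<^bsub>GL V\<^esub> K \<and>
        K \<otimes>\<^bsub>GL V\<^esub> \<rho> (X (i mod n)) = \<rho> (X (i mod n)) \<otimes>\<^bsub>GL V\<^esub> K"
    and KY: "\<forall>j. \<rho> (Y (Suc j mod m)) = K \<otimes>\<^bsub>GL V\<^esub> \<rho> (Y (j mod m)) \<and>
        K \<otimes>\<^bsub>GL V\<^esub> \<rho> (Y (j mod m)) = \<rho> (Y (j mod m)) \<otimes>\<^bsub>GL V\<^esub> K"
    by blast
  note K = K_closed KX[THEN spec, THEN conjunct1] KY[THEN spec, THEN conjunct1]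
    KX[THEN spec, THEN conjunct2] KY[THEN spec, THEN conjunct2]
  have K_hom: "K \<in> LinearCombinations.module_hom class_ring V V" using K(1) by (simp add: GL_def)
  have "K (\<rho> x v) = \<rho> x (K v)" if x: "x \<in> carrier (Qnm n m)" and v: "v \<in> carrier V" for x v
  proof -
    have "K \<otimes>\<^bsub>GL V\<^esub> \<rho> x = \<rho> x \<otimes>\<^bsub>GL V\<^esub> K"
    proof (cases x)
      case (X i)
      then have "i mod n = i" using x by (auto simp: Qnm_def)
      then show ?thesis using K(4)[of i] X by simp
    next
      case (Y j)
      then have "j mod m = j" using x by (auto simp: Qnm_def)
      then show ?thesis using K(5)[of j] Y by simp
    qed
    then show ?thesis
      using GL_mult_apply[OF K(1) rep_closed[OF x] v] GL_mult_apply[OF rep_closed[OF x] K(1) v] by simp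
  qed
  moreover have "countable (carrier (Qnm n m))" by (simp add: Qnm_def)
  ultimately obtain \<kappa> where \<kappa>: "\<And>v. v \<in> carrier V \<Longrightarrow> K v = \<kappa> \<odot>\<^bsub>V\<^esub> v"
    using irreducible_commuting_scalar[OF irr _ K_hom] by blast
  show ?thesis
  proof (rule that)
    fix i v assume v: "v \<in> carrier V"
    show "\<rho> (X (i mod n)) v = \<kappa> \<odot>\<^bsub>V\<^esub> \<rho> (X (Suc i mod n)) v"
      using GL_mult_apply[OF rep_closed[OF XQ] K(1) v, of "Suc i"] K(2)[of i] v
      by (simp add: \<kappa> rep_smult[OF XQ])
    show "\<rho> (Y (Suc i mod m)) v = \<kappa> \<odot>\<^bsub>V\<^esub> \<rho> (Y (i mod m)) v"
      using GL_mult_apply[OF K(1) rep_closed[OF YQ] v, of i] K(3)[of i] v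
      by (simp add: \<kappa> rep_vec_closed[OF YQ])
  qed
qed

text \<open>The number \<open>d\<close> is the multiplicative order. If
  \<open>\<alpha> ^ k = 1\<close>, then the remainder of \<open>k\<close> modulo \<open>d\<close> is
  an exponent with the same property below the least positive one, hence zero.\<close>

lemma primitive_root_exists_order:
  assumes "n > 0" "\<alpha> ^ n = (1::complex)"
  obtains d where "d > 0" "primitive_root_of_unity d \<alpha>" "\<And>k. \<alpha> ^ k = 1 \<Longrightarrow> d dvd k"
proof -
  define d where "d = (LEAST d. d > 0 \<and> \<alpha> ^ d = 1)"
  have d: "d > 0" "\<alpha> ^ d = 1"
    using LeastI[of "\<lambda>d. d > 0 \<and> \<alpha> ^ d = 1" n] assms by (auto simp: d_def)
  have min: "\<alpha> ^ k \<noteq> 1" if "0 < k" "k < d" for k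
    using not_less_Least[of k "\<lambda>d. d > 0 \<and> \<alpha> ^ d = 1"] that by (simp add: d_def)
  have "d dvd k" if "\<alpha> ^ k = 1" for k
  proof -
    have "\<alpha> ^ (k mod d) = 1" using power_mod_dvd[OF d(2) dvd_refl, of k] that by simp
    then have "k mod d = 0" using min[of "k mod d"] d(1) by auto
    then show ?thesis by auto
  qed
  then show ?thesis using that d min by (auto simp: primitive_root_of_unity_def)
qed

text \<open>Here \<open>\<alpha>\<close> is the inverse of the scalar \<open>\<kappa>\<close> above.\<close>

lemma irreducible_Qnm_twist:
  assumes irr: "irreducible_representation (Qnm n m) V \<rho>" and nm: "n \<ge> 1" "m \<ge> 1"
    and nontriv: "carrier V \<noteq> {\<zero>\<^bsub>V\<^esub>}"
  obtains \<alpha> where "\<alpha> ^ n = 1" "\<alpha> ^ m = 1"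
    "\<And>i v. v \<in> carrier V \<Longrightarrow> \<rho> (X (i mod n)) v = (\<alpha> ^ i / \<alpha>) \<odot>\<^bsub>V\<^esub> \<rho> (X (1 mod n)) v"
    "\<And>j v. v \<in> carrier V \<Longrightarrow> \<rho> (Y (j mod m)) v = (\<alpha> / \<alpha> ^ j) \<odot>\<^bsub>V\<^esub> \<rho> (Y (1 mod m)) v"
    "\<And>v. v \<in> carrier V \<Longrightarrow> \<rho> (Y (1 mod m)) (\<rho> (X (1 mod n)) v)
        = \<alpha> \<odot>\<^bsub>V\<^esub> \<rho> (X (1 mod n)) (\<rho> (Y (1 mod m)) v)"
proof -
  interpret quandle_representation "Qnm n m" V \<rho>
    using irr by (simp add: irreducible_representation_def)
  obtain \<kappa> where
    X\<kappa>: "\<And>i v. v \<in> carrier V \<Longrightarrow> \<rho> (X (i mod n)) v = \<kappa> \<odot>\<^bsub>V\<^esub> \<rho> (X (Suc i mod n)) v" and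
    Y\<kappa>: "\<And>j v. v \<in> carrier V \<Longrightarrow> \<rho> (Y (Suc j mod m)) v = \<kappa> \<odot>\<^bsub>V\<^esub> \<rho> (Y (j mod m)) v"
    using irreducible_Qnm_scalar[OF irr nm] by metis
  have XQ: "X (i mod n) \<in> carrier (Qnm n m)" and YQ: "Y (i mod m) \<in> carrier (Qnm n m)" for i
    using nm by (auto simp: Qnm_def)
  have X0: "\<rho> (X 0) v = \<kappa> ^ i \<odot>\<^bsub>V\<^esub> \<rho> (X (i mod n)) v" if v: "v \<in> carrier V" for i v
  proof (induction i)
    case 0
    then show ?case using rep_vec_closed[OF XQ v, of 0] by (simp add: smult_simps(4))
  next
    case (Suc i)
    then show ?case using rep_vec_closed[OF XQ v] X\<kappa>[OF v, of i]
      by (simp add: smult_simps(3) mult.commute)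
  qed
  have Y0: "\<rho> (Y (j mod m)) v = \<kappa> ^ j \<odot>\<^bsub>V\<^esub> \<rho> (Y 0) v" if v: "v \<in> carrier V" for j v
  proof (induction j)
    case 0
    then show ?case using rep_vec_closed[OF YQ v, of 0] by (simp add: smult_simps(4))
  next
    case (Suc j)
    then show ?case using rep_vec_closed[OF YQ v, of 0] Y\<kappa>[OF v, of j]
      by (simp add: smult_simps(3))
  qed
  obtain w where w: "w \<in> carrier V" "w \<noteq> \<zero>\<^bsub>V\<^esub>" using nontriv M.zero_closed by blast
  have surj: "\<exists>v\<in>carrier V. \<rho> x v = w" if "x \<in> carrier (Qnm n m)" for x
  proof -
    have "w \<in> \<rho> x ` carrier V" using rep_Bij[OF that] w(1) by (simp add: Bij_def bij_betw_def)
    then show ?thesis by blast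
  qed
  have one: "c = 1" if "w = c \<odot>\<^bsub>V\<^esub> w" for c
  proof -
    have "(c + (- 1)) \<odot>\<^bsub>V\<^esub> w = \<zero>\<^bsub>V\<^esub>"
      using that w add_minus_one_smult[of "c \<odot>\<^bsub>V\<^esub> w" w] by (simp only: smult_simps smult_closed_complex)
    then show ?thesis using w by (simp add: smult_eq_zero_iff)
  qed
  \<comment> \<open>Going once around the residues returns to \<open>X 0\<close> with the factor
    \<open>\<kappa> ^ n\<close>, which therefore fixes the nonzero vector \<open>w\<close> in the
    image of \<open>\<rho> (X 0)\<close>.\<close>
  have \<kappa>n: "\<kappa> ^ n = 1"
    using surj[OF XQ[of 0]] X0[of _ n] one by force
  have \<kappa>m: "\<kappa> ^ m = 1"
    using surj[OF YQ[of 0]] Y0[of _ m] one by force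
  have "\<kappa> \<noteq> 0" using \<kappa>n nm by (auto simp: power_0_left)
  define \<alpha> where "\<alpha> = inverse \<kappa>"
  have \<alpha>: "\<alpha> \<noteq> 0" "\<kappa> = inverse \<alpha>" using \<open>\<kappa> \<noteq> 0\<close> by (auto simp: \<alpha>_def)
  show ?thesis
  proof (rule that)
    show "\<alpha> ^ n = 1" "\<alpha> ^ m = 1" using \<kappa>n \<kappa>m by (simp_all add: \<alpha>_def power_inverse)
    fix i v assume v: "v \<in> carrier V"
    \<comment> \<open>The index is \<open>1 mod n\<close> because \<open>n = 1\<close> is still
      possible at this stage.\<close>
    define p where "p = \<rho> (X (1 mod n)) v"
    define q where "q = \<rho> (X (i mod n)) v"
    define r where "r = \<rho> (Y 0) v"
    have cl: "p \<in> carrier V" "q \<in> carrier V" "r \<in> carrier V"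
      unfolding p_def q_def r_def
      using rep_vec_closed[OF YQ v, of 0] by (auto intro: rep_vec_closed[OF XQ v] simp del: One_nat_def)
    have "\<kappa> ^ i \<odot>\<^bsub>V\<^esub> q = \<kappa> ^ 1 \<odot>\<^bsub>V\<^esub> p"
      unfolding p_def q_def using X0[OF v, of i] X0[OF v, of 1] by (simp only:)
    from arg_cong[OF this, of "\<lambda>w. \<alpha> ^ i \<odot>\<^bsub>V\<^esub> w"] have "q = (\<alpha> ^ i / \<alpha>) \<odot>\<^bsub>V\<^esub> p"
      using \<alpha> cl by (simp add: smult_simps(3,4) power_inverse divide_inverse)
    then show "\<rho> (X (i mod n)) v = (\<alpha> ^ i / \<alpha>) \<odot>\<^bsub>V\<^esub> \<rho> (X (1 mod n)) v"
      by (simp only: p_def q_def)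
    have "\<kappa> ^ i = (\<alpha> / \<alpha> ^ i) * \<kappa> ^ 1"
      unfolding \<alpha>(2) power_inverse using \<alpha>(1) by (simp add: field_simps)
    then have "\<kappa> ^ i \<odot>\<^bsub>V\<^esub> r = (\<alpha> / \<alpha> ^ i) \<odot>\<^bsub>V\<^esub> (\<kappa> ^ 1 \<odot>\<^bsub>V\<^esub> r)"
      by (simp only: smult_simps(3) cl)
    then show "\<rho> (Y (i mod m)) v = (\<alpha> / \<alpha> ^ i) \<odot>\<^bsub>V\<^esub> \<rho> (Y (1 mod m)) v"
      by (simp only: Y0[OF v, of i] Y0[OF v, of 1] r_def)
  next
    fix v assume v: "v \<in> carrier V"
    note cl = rep_vec_closed[OF YQ v]
    \<comment> \<open>Conjugation by \<open>Y 1\<close> turns \<open>X 1\<close> into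
      \<open>X 2\<close>, whose operator is \<open>\<alpha>\<close> times that of
      \<open>X 1\<close>; indices are taken modulo \<open>n\<close> and \<open>m\<close>.\<close>
    have "Y (1 mod m) \<triangleright>\<^bsub>Qnm n m\<^esub> X (1 mod n) = X (Suc (1 mod n) mod n)"
      by (simp add: Qnm_def)
    then have "Y (1 mod m) \<triangleright>\<^bsub>Qnm n m\<^esub> X (1 mod n) = X (Suc 1 mod n)"
      by (simp only: mod_Suc_eq)
    with rep_conj'[OF YQ XQ, of 1 1]
    have "\<rho> (Y (1 mod m)) \<otimes>\<^bsub>GL V\<^esub> \<rho> (X (1 mod n)) = \<rho> (X (Suc 1 mod n)) \<otimes>\<^bsub>GL V\<^esub> \<rho> (Y (1 mod m))"
      by (simp only:)
    from fun_cong[OF this, of v]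
    have "\<rho> (Y (1 mod m)) (\<rho> (X (1 mod n)) v) = \<rho> (X (Suc 1 mod n)) (\<rho> (Y (1 mod m)) v)"
      unfolding GL_mult_apply[OF rep_closed[OF YQ] rep_closed[OF XQ] v]
        GL_mult_apply[OF rep_closed[OF XQ] rep_closed[OF YQ] v] .
    moreover have "\<rho> (X (1 mod n)) (\<rho> (Y (1 mod m)) v) = \<kappa> \<odot>\<^bsub>V\<^esub> \<rho> (X (Suc 1 mod n)) (\<rho> (Y (1 mod m)) v)"
      by (rule X\<kappa>[OF cl])
    moreover have "p = \<alpha> \<odot>\<^bsub>V\<^esub> (\<kappa> \<odot>\<^bsub>V\<^esub> p)" if "p \<in> carrier V" for p
      using \<alpha> that by (simp add: smult_simps(3,4))
    from this[OF rep_vec_closed[OF XQ cl]]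
    have "\<rho> (X (Suc 1 mod n)) (\<rho> (Y (1 mod m)) v)
        = \<alpha> \<odot>\<^bsub>V\<^esub> (\<kappa> \<odot>\<^bsub>V\<^esub> \<rho> (X (Suc 1 mod n)) (\<rho> (Y (1 mod m)) v))" .
    ultimately show "\<rho> (Y (1 mod m)) (\<rho> (X (1 mod n)) v)
        = \<alpha> \<odot>\<^bsub>V\<^esub> \<rho> (X (1 mod n)) (\<rho> (Y (1 mod m)) v)"
      by (simp only:)
  qed
qed

text \<open>The vector \<open>v\<close> may be zero, so both lines and the zero space are
  excluded.\<close>

lemma (in complex_vectorspace) not_dim_greater_one_line:
  assumes v: "v \<in> carrier V" and line: "\<And>w. w \<in> carrier V \<Longrightarrow> \<exists>c. w = c \<odot>\<^bsub>V\<^esub> v"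
  shows "\<not> dim_greater_one V"
proof -
  interpret sp: submodule class_ring "span {v}" V using span_is_submodule v by simp
  have "v \<in> span {v}" using in_own_span[of "{v}"] v by simp
  then have "carrier V \<subseteq> span {v}" using line sp.smult_closed by fastforce
  then have gen: "gen_set {v}" using span_is_subset2[of "{v}"] v by auto
  then have "fin_dim" "dim \<le> 1" using v gen_ge_dim[of "{v}"] by (auto simp: fin_dim_def)
  then show ?thesis by (simp add: dim_greater_one_def)
qed

text \<open>The comparison map runs from the standard representation to \<open>V\<close> and sends
  the unit vectors to the vectors \<open>b^k v\<close>. As a nonzero intertwiner between irreducible
  representations it is bijective, which gives independence and spanning of these vectors at
  once.\<close>

lemma irreducible_Qnm_classification:
  fixes V :: "(complex, 'v, 'w) module_scheme"
  assumes irr: "irreducible_representation (Qnm n m) V \<rho>" and dim: "dim_greater_one V"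
    and nm: "n \<ge> 1" "m \<ge> 1"
  shows "\<exists>d \<alpha> l \<beta>. rho_parameters n m d \<alpha> l \<beta> \<and>
      equivalent_representations (Qnm n m) V \<rho> (complex_space d) (rho d \<alpha> l \<beta>)"
proof -
  interpret quandle_representation "Qnm n m" V \<rho>
    using irr by (simp add: irreducible_representation_def)
  have nontriv: "carrier V \<noteq> {\<zero>\<^bsub>V\<^esub>}"
    using not_dim_greater_one_line[of "\<zero>\<^bsub>V\<^esub>"] dim by (metis M.zero_closed singletonD smult_simps(6))
  obtain \<alpha> where \<alpha>nm: "\<alpha> ^ n = 1" "\<alpha> ^ m = 1"
    and \<rho>X: "\<And>i v. v \<in> carrier V \<Longrightarrow> \<rho> (X (i mod n)) v = (\<alpha> ^ i / \<alpha>) \<odot>\<^bsub>V\<^esub> \<rho> (X (1 mod n)) v"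
    and \<rho>Y: "\<And>j v. v \<in> carrier V \<Longrightarrow> \<rho> (Y (j mod m)) v = (\<alpha> / \<alpha> ^ j) \<odot>\<^bsub>V\<^esub> \<rho> (Y (1 mod m)) v"
    and twist: "\<And>v. v \<in> carrier V \<Longrightarrow> \<rho> (Y (1 mod m)) (\<rho> (X (1 mod n)) v)
        = \<alpha> \<odot>\<^bsub>V\<^esub> \<rho> (X (1 mod n)) (\<rho> (Y (1 mod m)) v)"
    using irreducible_Qnm_twist[OF irr nm nontriv] by blast
  have "\<alpha> \<noteq> 0" using \<alpha>nm(1) nm by (auto simp: power_0_left)
  obtain d where d: "d > 0" "primitive_root_of_unity d \<alpha>" "\<And>k. \<alpha> ^ k = 1 \<Longrightarrow> d dvd k"
    using primitive_root_exists_order[of n \<alpha>] \<alpha>nm(1) nm by auto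
  have \<alpha>d: "\<alpha> ^ d = 1" using d(2) by (simp add: primitive_root_of_unity_def)
  define a where "a = \<rho> (X (1 mod n))"
  define b where "b = \<rho> (Y (1 mod m))"
  have 1: "X (1 mod n) \<in> carrier (Qnm n m)" "Y (1 mod m) \<in> carrier (Qnm n m)"
    using nm by (auto simp: Qnm_def)
  interpret a: complex_endomorphism V a unfolding a_def by (rule rep_endomorphism[OF 1(1)])
  interpret b: complex_endomorphism V b unfolding b_def by (rule rep_endomorphism[OF 1(2)])
  have inj: "w = \<zero>\<^bsub>V\<^esub>" if "x \<in> carrier (Qnm n m)" "w \<in> carrier V" "\<rho> x w = \<zero>\<^bsub>V\<^esub>" for x w
    using rep_Bij[OF that(1)] that rep_zero[OF that(1)]
    by (auto simp: Bij_def bij_betw_def dest: inj_onD[where x = w and y = "\<zero>\<^bsub>V\<^esub>"])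
  \<comment> \<open>Every operator of the representation is a scalar multiple of \<open>a\<close> or
    \<open>b\<close>, so commutation need only be checked against these two.\<close>
  have \<rho>_cases: "(\<exists>i. x = X i \<and> (\<forall>v\<in>carrier V. \<rho> x v = (\<alpha> ^ i / \<alpha>) \<odot>\<^bsub>V\<^esub> a v)) \<or>
      (\<exists>j. x = Y j \<and> (\<forall>v\<in>carrier V. \<rho> x v = (\<alpha> / \<alpha> ^ j) \<odot>\<^bsub>V\<^esub> b v))"
    if "x \<in> carrier (Qnm n m)" for x
  proof (cases x)
    case (X i)
    then have "i mod n = i" using that by (auto simp: Qnm_def)
    then show ?thesis using \<rho>X[of _ i] X unfolding a_def by (intro disjI1 exI[of _ i]) simp
  next
    case (Y j)
    then have "j mod m = j" using that by (auto simp: Qnm_def)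
    then show ?thesis using \<rho>Y[of _ j] Y unfolding b_def by (intro disjI2 exI[of _ j]) simp
  qed
  have ba: "b (a v) = \<alpha> \<odot>\<^bsub>V\<^esub> a (b v)" if "v \<in> carrier V" for v
    using twist[OF that] by (simp only: a_def b_def)
  have b_funpow_a: "(b ^^ k) (a v) = \<alpha> ^ k \<odot>\<^bsub>V\<^esub> a ((b ^^ k) v)" if "v \<in> carrier V" for k v
    using that by (induction k) (simp_all add: smult_simps ba b.T_smult mult.commute)
  have b_a_funpow: "b ((a ^^ k) v) = \<alpha> ^ k \<odot>\<^bsub>V\<^esub> (a ^^ k) (b v)" if "v \<in> carrier V" for k v
    using that by (induction k) (simp_all add: smult_simps ba a.T_smult mult.commute)
  interpret ad: complex_endomorphism V "a ^^ d" by unfold_locales (rule a.funpow_hom)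
  interpret bd: complex_endomorphism V "b ^^ d" by unfold_locales (rule b.funpow_hom)
  have countable: "countable (carrier (Qnm n m))" by (simp add: Qnm_def)
  \<comment> \<open>Moving \<open>b\<close> past \<open>a^d\<close> costs the factor
    \<open>\<alpha> ^ d = 1\<close>.\<close>
  have "(a ^^ d) (\<rho> x v) = \<rho> x ((a ^^ d) v)" if "x \<in> carrier (Qnm n m)" "v \<in> carrier V" for x v
    using \<rho>_cases[OF that(1)] that(2) b_a_funpow[OF that(2), of d] \<alpha>d
    by (auto simp: ad.T_smult smult_simps funpow_swap1[of a])
  then obtain p where p: "\<And>v. v \<in> carrier V \<Longrightarrow> (a ^^ d) v = p \<odot>\<^bsub>V\<^esub> v"
    using irreducible_commuting_scalar[OF irr countable ad.T_hom] by blast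
  have "(b ^^ d) (\<rho> x v) = \<rho> x ((b ^^ d) v)" if "x \<in> carrier (Qnm n m)" "v \<in> carrier V" for x v
    using \<rho>_cases[OF that(1)] that(2) b_funpow_a[OF that(2), of d] \<alpha>d
    by (auto simp: bd.T_smult smult_simps funpow_swap1[of b])
  then obtain l where l: "\<And>v. v \<in> carrier V \<Longrightarrow> (b ^^ d) v = l \<odot>\<^bsub>V\<^esub> v"
    using irreducible_commuting_scalar[OF irr countable bd.T_hom] by blast
  obtain u where u: "u \<in> carrier V" "u \<noteq> \<zero>\<^bsub>V\<^esub>" using nontriv M.zero_closed by blast
  \<comment> \<open>The polynomial \<open>x^d - p\<close> annihilates \<open>u\<close>, which
    provides an eigenvector of \<open>a\<close> even though \<open>V\<close> is not yet known to be
    finite-dimensional.\<close>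
  have "a.poly_op (monom 1 d + [:- p:]) u = p \<odot>\<^bsub>V\<^esub> u \<oplus>\<^bsub>V\<^esub> (- p) \<odot>\<^bsub>V\<^esub> u"
    using u by (simp add: a.poly_op_add a.poly_op_monom p)
  also have "\<dots> = \<zero>\<^bsub>V\<^esub>" using u smult_simps(1)[of u p "- p"] by (simp add: smult_simps(5))
  finally have "a.poly_op (monom 1 d + [:- p:]) u = \<zero>\<^bsub>V\<^esub>" .
  moreover have "coeff (monom 1 d + [:- p:]) d \<noteq> 0"
    using d(1) by (cases d) auto
  then have "monom 1 d + [:- p:] \<noteq> 0" by force
  ultimately obtain \<beta> v where v: "v \<in> carrier V" "v \<noteq> \<zero>\<^bsub>V\<^esub>" and av: "a v = \<beta> \<odot>\<^bsub>V\<^esub> v"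
    using a.annihilated_imp_eigenvector u by metis
  have "\<beta> \<noteq> 0"
    using inj[OF 1(1) v(1)] v av unfolding a_def by (auto simp: smult_simps(5))
  have b_inj: "w = \<zero>\<^bsub>V\<^esub>" if "w \<in> carrier V" "(b ^^ k) w = \<zero>\<^bsub>V\<^esub>" for w k
    using that
  proof (induction k)
    case (Suc k)
    then show ?case using inj[OF 1(2), of "(b ^^ k) w"] b.funpow_closed[of w k] by (simp add: b_def)
  qed simp
  have "l \<noteq> 0"
    using b_inj[OF v(1), of d] v l[OF v(1)] by (auto simp: smult_simps(5))
  \<comment> \<open>For \<open>d = 1\<close> the operators \<open>a\<close> and \<open>b\<close>
    would themselves be scalars, and the line through \<open>v\<close> would be all of
    \<open>V\<close>.\<close>
  have "d \<noteq> 1"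
  proof
    assume "d = 1"
    then have \<rho>_scalar: "\<exists>c. \<forall>w\<in>carrier V. \<rho> x w = c \<odot>\<^bsub>V\<^esub> w" if "x \<in> carrier (Qnm n m)" for x
      using \<rho>_cases[OF that] p l by (auto simp: smult_simps(3))
    let ?W = "{w. \<exists>c. w = c \<odot>\<^bsub>V\<^esub> v}"
    have "VectorSpace.subspace class_ring ?W V"
    proof (rule subspaceI)
      show "\<zero>\<^bsub>V\<^esub> \<in> ?W" using smult_simps(5)[OF v(1), symmetric] by blast
      show "x \<oplus>\<^bsub>V\<^esub> y \<in> ?W" if "x \<in> ?W" "y \<in> ?W" for x y
        using that v(1) by (auto simp: smult_simps(1)[symmetric])
      show "c \<odot>\<^bsub>V\<^esub> x \<in> ?W" if "x \<in> ?W" for c x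
        using that v(1) by (auto simp: smult_simps(3))
    qed (use v in auto)
    moreover have "\<rho> x w \<in> ?W" if "x \<in> carrier (Qnm n m)" "w \<in> ?W" for x w
      using \<rho>_scalar[OF that(1)] that(2) v(1) by (auto simp: smult_simps(3))
    ultimately have "?W = {\<zero>\<^bsub>V\<^esub>} \<or> ?W = carrier V"
      using irr unfolding irreducible_representation_def by blast
    moreover have "v \<in> ?W" using smult_simps(4)[OF v(1), symmetric] by blast
    ultimately have "carrier V = ?W" using v(2) by blast
    then have "\<not> dim_greater_one V" by (intro not_dim_greater_one_line[OF v(1)]) blast
    then show False using dim by simp
  qed
  then have "d > 1" using d(1) by simp
  then have params: "rho_parameters n m d \<alpha> l \<beta>"
    using d \<alpha>nm \<open>l \<noteq> 0\<close> \<open>\<beta> \<noteq> 0\<close> by (simp add: rho_parameters_def)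
  \<comment> \<open>The sums run over \<open>{..Suc e}\<close>, a form from which the first or the
    last summand can be split off.\<close>
  obtain e where e: "d = Suc (Suc e)" using \<open>d > 1\<close> by (metis One_nat_def less_imp_Suc_add add_Suc)
  define basis_vec where "basis_vec k = (b ^^ k) v" for k
  have bv [simp, intro]: "basis_vec k \<in> carrier V" for k using v(1) by (simp add: basis_vec_def)
  have a_bv: "a (basis_vec k) = (\<beta> / \<alpha> ^ k) \<odot>\<^bsub>V\<^esub> basis_vec k" for k
  proof -
    have "\<beta> \<odot>\<^bsub>V\<^esub> basis_vec k = \<alpha> ^ k \<odot>\<^bsub>V\<^esub> a (basis_vec k)"
    proof -
      interpret bk: complex_endomorphism V "b ^^ k" by unfold_locales (rule b.funpow_hom)
      show ?thesis using b_funpow_a[OF v(1), of k] v(1) by (simp add: av bk.T_smult basis_vec_def)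
    qed
    from arg_cong[OF this, of "\<lambda>w. inverse (\<alpha> ^ k) \<odot>\<^bsub>V\<^esub> w"] show ?thesis
      using \<open>\<alpha> \<noteq> 0\<close> by (simp add: smult_simps(3,4) divide_inverse mult.commute)
  qed
  have b_bv: "b (basis_vec k) = basis_vec (Suc k)" for k by (simp add: basis_vec_def)
  have bv_d: "basis_vec (Suc (Suc e)) = l \<odot>\<^bsub>V\<^esub> basis_vec 0" using l[OF v(1)] e by (simp add: basis_vec_def)
  define T where "T c = (\<Oplus>\<^bsub>V\<^esub>k\<in>{..Suc e}. (c $ k) \<odot>\<^bsub>V\<^esub> basis_vec k)" for c
  have T_hom: "T \<in> LinearCombinations.module_hom class_ring (complex_space d) V"
  proof -
    have "T (x + y) = T x \<oplus>\<^bsub>V\<^esub> T y" if "x \<in> carrier_vec d" "y \<in> carrier_vec d" for x y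
    proof -
      have "T (x + y) = (\<Oplus>\<^bsub>V\<^esub>k\<in>{..Suc e}. (x $ k) \<odot>\<^bsub>V\<^esub> basis_vec k \<oplus>\<^bsub>V\<^esub> (y $ k) \<odot>\<^bsub>V\<^esub> basis_vec k)"
        unfolding T_def
        by (rule M.finsum_cong') (use that e in \<open>auto simp: smult_simps(1)\<close>)
      then show ?thesis unfolding T_def by (simp add: M.finsum_addf)
    qed
    moreover have "T (c \<cdot>\<^sub>v x) = c \<odot>\<^bsub>V\<^esub> T x" if "x \<in> carrier_vec d" for c x
    proof -
      have "T (c \<cdot>\<^sub>v x) = (\<Oplus>\<^bsub>V\<^esub>k\<in>{..Suc e}. c \<odot>\<^bsub>V\<^esub> ((x $ k) \<odot>\<^bsub>V\<^esub> basis_vec k))"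
        unfolding T_def
        by (rule M.finsum_cong') (use that e in \<open>auto simp: smult_simps(3)\<close>)
      then show ?thesis unfolding T_def using finsum_smult[of c "\<lambda>k. (x $ k) \<odot>\<^bsub>V\<^esub> basis_vec k" "{..Suc e}"]
        by (simp add: Pi_iff)
    qed
    moreover have "T x \<in> carrier V" for x unfolding T_def by (rule M.finsum_closed) auto
    ultimately show ?thesis
      by (auto simp: LinearCombinations.module_hom_def complex_space_simps)
  qed
  have T_comm: "T (rho d \<alpha> l \<beta> x c) = \<rho> x (T c)"
    if x: "x \<in> carrier (Qnm n m)" and "c \<in> carrier (complex_space d)" for x c
  proof -
    have c: "c \<in> carrier_vec d" using that by (simp add: complex_space_simps)
    interpret R: complex_endomorphism V "\<rho> x" by (rule rep_endomorphism[OF x])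
    have "\<rho> x (T c) = (\<Oplus>\<^bsub>V\<^esub>k\<in>{..Suc e}. \<rho> x ((c $ k) \<odot>\<^bsub>V\<^esub> basis_vec k))"
      unfolding T_def by (rule R.T_finsum) auto
    also have "\<dots> = (\<Oplus>\<^bsub>V\<^esub>k\<in>{..Suc e}. (c $ k) \<odot>\<^bsub>V\<^esub> \<rho> x (basis_vec k))"
      by (rule M.finsum_cong') (auto simp: R.T_smult)
    finally have \<rho>T: "\<rho> x (T c) = (\<Oplus>\<^bsub>V\<^esub>k\<in>{..Suc e}. (c $ k) \<odot>\<^bsub>V\<^esub> \<rho> x (basis_vec k))" .
    from \<rho>_cases[OF x] show ?thesis
    proof (elim disjE exE conjE)
      fix i assume i: "x = X i" "\<forall>v\<in>carrier V. \<rho> x v = (\<alpha> ^ i / \<alpha>) \<odot>\<^bsub>V\<^esub> a v"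
      have "T (rho d \<alpha> l \<beta> x c) = (\<Oplus>\<^bsub>V\<^esub>k\<in>{..Suc e}. (c $ k) \<odot>\<^bsub>V\<^esub> \<rho> x (basis_vec k))"
        unfolding T_def
      proof (rule M.finsum_cong')
        fix k assume "k \<in> {..Suc e}"
        then have "k < d" using e by simp
        then have "rho d \<alpha> l \<beta> x c $ k = c $ k * (\<alpha> ^ i / \<alpha> * (\<beta> / \<alpha> ^ k))"
          by (simp add: i(1) rho_index(1)[OF \<open>\<alpha> \<noteq> 0\<close> c])
        moreover have "\<rho> x (basis_vec k) = (\<alpha> ^ i / \<alpha> * (\<beta> / \<alpha> ^ k)) \<odot>\<^bsub>V\<^esub> basis_vec k"
          using i(2)[rule_format, OF bv[of k]] smult_simps(3)[OF bv[of k]] by (simp only: a_bv)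
        ultimately show "(rho d \<alpha> l \<beta> x c $ k) \<odot>\<^bsub>V\<^esub> basis_vec k = (c $ k) \<odot>\<^bsub>V\<^esub> \<rho> x (basis_vec k)"
          using smult_simps(3)[OF bv[of k]] by (simp only:)
      qed (use x in auto)
      with \<rho>T show ?thesis by (rule trans[OF _ sym, rotated])
    next
      fix j assume j: "x = Y j" "\<forall>v\<in>carrier V. \<rho> x v = (\<alpha> / \<alpha> ^ j) \<odot>\<^bsub>V\<^esub> b v"
      let ?s = "\<alpha> / \<alpha> ^ j"
      \<comment> \<open>The part of the sum that is merely shifted. The remaining term is the
        wrap-around: \<open>b^d v = l v\<close> carries the last coordinate to position 0.\<close>
      let ?S = "\<Oplus>\<^bsub>V\<^esub>k\<in>{..e}. (?s * c $ k) \<odot>\<^bsub>V\<^esub> basis_vec (Suc k)"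
      have idx: "rho d \<alpha> l \<beta> x c $ k = ?s * (if k = 0 then l * c $ (Suc e) else c $ (k - 1))"
        if "k \<le> Suc e" for k
      proof -
        have "k < d" "d - 1 = Suc e" using that e by simp_all
        then show ?thesis by (simp add: j(1) rho_index(2)[OF \<open>\<alpha> \<noteq> 0\<close> c])
      qed
      have SV: "?S \<in> carrier V" by (rule M.finsum_closed) auto
      have "T (rho d \<alpha> l \<beta> x c) =
          (\<Oplus>\<^bsub>V\<^esub>k\<in>{..e}. (rho d \<alpha> l \<beta> x c $ Suc k) \<odot>\<^bsub>V\<^esub> basis_vec (Suc k)) \<oplus>\<^bsub>V\<^esub>
          (rho d \<alpha> l \<beta> x c $ 0) \<odot>\<^bsub>V\<^esub> basis_vec 0"
        unfolding T_def by (rule M.finsum_Suc2) auto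
      also have "(\<Oplus>\<^bsub>V\<^esub>k\<in>{..e}. (rho d \<alpha> l \<beta> x c $ Suc k) \<odot>\<^bsub>V\<^esub> basis_vec (Suc k)) = ?S"
        by (rule M.finsum_cong') (auto simp: idx)
      also have "(rho d \<alpha> l \<beta> x c $ 0) \<odot>\<^bsub>V\<^esub> basis_vec 0 = (?s * c $ Suc e) \<odot>\<^bsub>V\<^esub> basis_vec (Suc (Suc e))"
        by (simp add: idx bv_d smult_simps(3) mult_ac)
      finally have T1: "T (rho d \<alpha> l \<beta> x c) = ?S \<oplus>\<^bsub>V\<^esub> (?s * c $ Suc e) \<odot>\<^bsub>V\<^esub> basis_vec (Suc (Suc e))" .
      have "\<rho> x (T c) = (\<Oplus>\<^bsub>V\<^esub>k\<in>{..Suc e}. (?s * c $ k) \<odot>\<^bsub>V\<^esub> basis_vec (Suc k))"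
        unfolding \<rho>T
        by (rule M.finsum_cong') (use j(2) in \<open>auto simp: b_bv smult_simps(3) mult.commute\<close>)
      also have "\<dots> = (?s * c $ Suc e) \<odot>\<^bsub>V\<^esub> basis_vec (Suc (Suc e)) \<oplus>\<^bsub>V\<^esub> ?S"
        by (rule M.finsum_Suc) auto
      finally show ?thesis using T1 SV by (simp add: M.a_comm)
    qed
  qed
  \<comment> \<open>This witnesses that the intertwiner is nonzero.\<close>
  have T_unit: "T (unit_vec d 0) = v"
  proof -
    have "T (unit_vec d 0) = (\<Oplus>\<^bsub>V\<^esub>k\<in>{..Suc e}. if 0 = k then basis_vec k else \<zero>\<^bsub>V\<^esub>)"
      unfolding T_def by (rule M.finsum_cong') (use e in \<open>auto simp: smult_simps(4,5)\<close>)
    also have "\<dots> = basis_vec 0" by (rule M.finsum_singleton) auto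
    finally show ?thesis by (simp add: basis_vec_def)
  qed
  have lin: "linear_map class_ring (complex_space d) V T"
    by (intro linear_mapI vec_vs vectorspace_axioms T_hom)
  have irr_rho: "irreducible_representation (Qnm n m) (complex_space d) (rho d \<alpha> l \<beta>)"
    by (rule rho_irreducible[OF params nm])
  have "bij_betw T (carrier (complex_space d)) (carrier V)"
  proof (rule irreducible_intertwiner_bij[OF irr_rho irr lin])
    show "unit_vec d 0 \<in> carrier (complex_space d)" by (simp add: complex_space_simps)
    show "T (unit_vec d 0) \<noteq> \<zero>\<^bsub>V\<^esub>" using T_unit v(2) by simp
  qed (rule T_comm)
  then have "equivalent_representations (Qnm n m) (complex_space d) (rho d \<alpha> l \<beta>) V \<rho>"
    unfolding equivalent_representations_def using lin T_comm by blast
  then have "equivalent_representations (Qnm n m) V \<rho> (complex_space d) (rho d \<alpha> l \<beta>)"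
    by (rule equivalent_representations_sym) (simp add: complex_space_simps)
  then show ?thesis using params by blast
qed

theorem theorem5p5:
  fixes n m :: nat
  assumes "n \<ge> 1" and "m \<ge> 1"
  shows
    "(\<forall>d \<alpha> l \<beta>. rho_parameters n m d \<alpha> l \<beta> \<longrightarrow>
        irreducible_representation (Qnm n m) (complex_space d) (rho d \<alpha> l \<beta>) \<and>
        dim_greater_one (complex_space d)) \<and>
     (\<forall>(V :: (complex, 'v, 'w) module_scheme) \<rho>.
        irreducible_representation (Qnm n m) V \<rho> \<and> dim_greater_one V \<longrightarrow>
        (\<exists>d \<alpha> l \<beta>. rho_parameters n m d \<alpha> l \<beta> \<and>
           equivalent_representations (Qnm n m) V \<rho> (complex_space d) (rho d \<alpha> l \<beta>))) \<and>
     (\<forall>d \<alpha> l \<beta> d' \<alpha>' l' \<beta>'.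
        rho_parameters n m d \<alpha> l \<beta> \<and> rho_parameters n m d' \<alpha>' l' \<beta>' \<longrightarrow>
        (equivalent_representations (Qnm n m)
           (complex_space d) (rho d \<alpha> l \<beta>) (complex_space d') (rho d' \<alpha>' l' \<beta>') \<longleftrightarrow>
         \<alpha> = \<alpha>' \<and> l = l' \<and> (\<exists>i::int. \<beta> = \<beta>' * \<alpha> powi i)))"
  by (intro conjI allI impI; (elim conjE)?)
    (assumption | rule rho_irreducible[OF _ assms] irreducible_Qnm_classification[OF _ _ assms]
      rho_equivalent_iff[OF _ _ assms] dim_greater_one_complex_space rho_parametersD(1))+

end
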